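(* Let $P$ be a set of $n \geq 5$ points in convex position in the plane, and let $G(P)$ be its path graph. Then the automorphism group $\mathrm{Aut}(G(P))$ (automorphisms of $G(P)$ as an abstract graph) is isomorphic to $D_n$, the dihedral group of order $2n$.
   Context: For a finite set $P$ of points in the plane, $K(P)$ denotes the complete geometric graph on $P$: its vertices are the points of $P$ and its edges are all closed straight-line segments between pairs of distinct points. A simple (non-crossing) spanning path of $P$ is a spanning path of $K(P)$ no two of whose edges (segments) cross. The path graph $G(P)$ is the abstract graph whose vertices are the simple spanning paths of $P$, where two such paths are adjacent iff they differ in exactly two edges, i.e., one can be obtained from the other by deleting one edge and adding another edge. *)

theory Defs
  imports
    "HOL-Analysis.Analysis"
    "HOL-Algebra.Bij"
    "Graph_Theory.Pair_Digraph"
    "Graph_Theory.Vertex_Walk"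
begin

type_synonym plane = "real^2"

definition convex_position :: "plane set \<Rightarrow> bool" where
  "convex_position P \<longleftrightarrow> (\<forall>p\<in>P. p extreme_point_of (convex hull P))"

text \<open>An undirected graph is a \<^typ>\<open>'a pair_pre_digraph\<close> with a symmetric, irreflexive arc
  relation.  In the complete geometric graph the arcs \<open>(p, q)\<close> and \<open>(q, p)\<close> both stand for the
  edge \<^term>\<open>closed_segment p q\<close>.\<close>

definition complete_geometric_graph :: "plane set \<Rightarrow> plane pair_pre_digraph" where
  "complete_geometric_graph P = \<lparr>pverts = P, parcs = {(p, q). p \<in> P \<and> q \<in> P \<and> p \<noteq> q}\<rparr>"

text \<open>The edges of the path visiting the vertices in the order of the list; the list and
  its reversal give the same edge set.\<close>

definition path_edges :: "plane list \<Rightarrow> plane set set" where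
  "path_edges xs = (\<lambda>(p, q). closed_segment p q) ` set (vwalk_arcs xs)"

text \<open>A spanning path is an undirected subgraph, so it is identified with its set of edges.\<close>

definition spanning_paths :: "plane set \<Rightarrow> plane set set set" where
  "spanning_paths P =
    {path_edges xs |xs. vpath xs (with_proj (complete_geometric_graph P)) \<and> set xs = P}"

text \<open>For \<^prop>\<open>p \<noteq> q\<close> the relative interior of \<^term>\<open>closed_segment p q\<close> is
  \<^term>\<open>open_segment p q\<close>: two edges cross if they share a point interior to both.\<close>

definition crossing :: "plane set \<Rightarrow> plane set \<Rightarrow> bool" where
  "crossing e f \<longleftrightarrow> e \<noteq> f \<and> rel_interior e \<inter> rel_interior f \<noteq> {}"

definition simple_spanning_paths :: "plane set \<Rightarrow> plane set set set" where
  "simple_spanning_paths P = {S \<in> spanning_paths P. \<forall>e\<in>S. \<forall>f\<in>S. \<not> crossing e f}"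

definition path_graph :: "plane set \<Rightarrow> plane set set pair_pre_digraph" where
  "path_graph P =
    \<lparr>pverts = simple_spanning_paths P,
     parcs = {(S, T). S \<in> simple_spanning_paths P \<and> T \<in> simple_spanning_paths P \<and>
                      (\<exists>e\<in>S. \<exists>f. f \<notin> S \<and> T = insert f (S - {e}))}\<rparr>"

definition graph_automorphisms :: "'a pair_pre_digraph \<Rightarrow> ('a \<Rightarrow> 'a) set" where
  "graph_automorphisms G =
    {h \<in> Bij (pverts G).
      \<forall>u\<in>pverts G. \<forall>v\<in>pverts G. (h u, h v) \<in> parcs G \<longleftrightarrow> (u, v) \<in> parcs G}"

definition Aut :: "'a pair_pre_digraph \<Rightarrow> ('a \<Rightarrow> 'a) monoid" where
  "Aut G = BijGroup (pverts G) \<lparr>carrier := graph_automorphisms G\<rparr>"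

text \<open>The dihedral group of order \<open>2n\<close> as the semidirect product of the integers modulo \<open>n\<close>
  with the group of order two acting by negation: \<open>(a, s)\<close> is the symmetry
  \<open>x \<mapsto> a + x\<close> (\<open>s = False\<close>) or \<open>x \<mapsto> a - x\<close> (\<open>s = True\<close>) of the
  vertices of the regular \<open>n\<close>-gon, numbered cyclically.\<close>

definition dihedral_group :: "nat \<Rightarrow> (int \<times> bool) monoid" where
  "dihedral_group n =
    \<lparr>carrier = {0..<int n} \<times> UNIV,
     mult = (\<lambda>(a, s) (b, t). ((if s then a - b else a + b) mod int n, s \<noteq> t)),
     one = (0, False)\<rparr>"

lemma group_Aut: "group (Aut G)"
proof -
  let ?V = "pverts G"
  interpret B: group "BijGroup ?V" by (rule group_BijGroup)
  have "subgroup (graph_automorphisms G) (BijGroup ?V)"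
  proof (rule B.subgroupI)
    show "graph_automorphisms G \<subseteq> carrier (BijGroup ?V)"
      by (auto simp: graph_automorphisms_def BijGroup_def)
    have "(\<lambda>x\<in>?V. x) \<in> graph_automorphisms G"
      by (simp add: graph_automorphisms_def id_Bij)
    then show "graph_automorphisms G \<noteq> {}" by blast
  next
    fix h assume h: "h \<in> graph_automorphisms G"
    then have hB: "h \<in> Bij ?V" by (simp add: graph_automorphisms_def)
    then have img: "h ` ?V = ?V" by (simp add: Bij_def bij_betw_def)
    have inv: "inv\<^bsub>BijGroup ?V\<^esub> h = (\<lambda>x\<in>?V. inv_into ?V h x)"
      using hB by (rule inv_BijGroup)
    have "(inv_into ?V h u, inv_into ?V h v) \<in> parcs G \<longleftrightarrow> (u, v) \<in> parcs G"
      if "u \<in> ?V" "v \<in> ?V" for u v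
    proof -
      have mem: "inv_into ?V h u \<in> ?V" "inv_into ?V h v \<in> ?V"
        using that hB by (simp_all add: Bij_inv_into_mem)
      have "h (inv_into ?V h u) = u" "h (inv_into ?V h v) = v"
        using that img by (simp_all add: f_inv_into_f)
      moreover have "(h (inv_into ?V h u), h (inv_into ?V h v)) \<in> parcs G
          \<longleftrightarrow> (inv_into ?V h u, inv_into ?V h v) \<in> parcs G"
        using h mem by (simp add: graph_automorphisms_def)
      ultimately show ?thesis by simp
    qed
    then show "inv\<^bsub>BijGroup ?V\<^esub> h \<in> graph_automorphisms G"
      unfolding inv using hB by (simp add: graph_automorphisms_def restrict_inv_into_Bij)
  next
    fix g h assume gh: "g \<in> graph_automorphisms G" "h \<in> graph_automorphisms G"
    then have "g \<in> Bij ?V" "h \<in> Bij ?V" by (simp_all add: graph_automorphisms_def)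
    moreover from this have "h u \<in> ?V" if "u \<in> ?V" for u
      using that Bij_imp_funcset by blast
    ultimately show "g \<otimes>\<^bsub>BijGroup ?V\<^esub> h \<in> graph_automorphisms G"
      using gh by (auto simp: graph_automorphisms_def BijGroup_def compose_Bij compose_eq)
  qed
  then show ?thesis
    unfolding Aut_def by (rule B.subgroup_imp_group)
qed

lemma group_dihedral_group:
  assumes "n > 0"
  shows "group (dihedral_group n)"
proof (rule groupI)
  fix x assume x: "x \<in> carrier (dihedral_group n)"
  obtain a s where [simp]: "x = (a, s)" by (cases x)
  have "(if s then a else (- a) mod int n, s) \<in> carrier (dihedral_group n)"
    using x assms by (auto simp: dihedral_group_def)
  moreover have "(if s then a else (- a) mod int n, s) \<otimes>\<^bsub>dihedral_group n\<^esub> x = \<one>\<^bsub>dihedral_group n\<^esub>"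
    by (simp add: dihedral_group_def mod_simps)
  ultimately show "\<exists>y\<in>carrier (dihedral_group n). y \<otimes>\<^bsub>dihedral_group n\<^esub> x = \<one>\<^bsub>dihedral_group n\<^esub>"
    by blast
qed (use assms in \<open>auto simp: dihedral_group_def mod_simps algebra_simps\<close>)

lemma card_dihedral_group: "card (carrier (dihedral_group n)) = 2 * n"
  by (simp add: dihedral_group_def card_cartesian_product)

lemma pair_bidirected_digraph_path_graph: "pair_bidirected_digraph (path_graph P)"
proof
  have "(T, S) \<in> parcs (path_graph P)" if "(S, T) \<in> parcs (path_graph P)" for S T
  proof -
    from that obtain e f where "e \<in> S" "f \<notin> S" "T = insert f (S - {e})"
      by (auto simp: path_graph_def)
    then have "f \<in> T" "e \<notin> T" "S = insert e (T - {f})" by auto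
    with that show ?thesis by (auto simp: path_graph_def)
  qed
  then show "symmetric (with_proj (path_graph P))"
    by (auto simp: symmetric_def intro: symI)
qed (auto simp: path_graph_def)

end

theory Submission
  imports Defs
begin

text \<open>Number the points \<open>0, \<dots>, n - 1\<close> in convex order; two segments then cross iff their end points
  interleave, and a leaf edge of a simple spanning path must be a side of the polygon, since the
  rest of the path stays on one side of it. The \<open>n\<close> boundary paths \<open>B i\<close> (all sides but one)
  form the only clique of size \<open>n\<close>: the members of a clique with more than four elements arise from
  a single edge set by deleting one edge, and if there are \<open>n\<close> of them, that edge set is the whole
  polygon. So every automorphism permutes the \<open>B i\<close>; as \<open>B i\<close> and \<open>B j\<close> have a
  common non-boundary neighbour iff the sides \<open>i\<close> and \<open>j\<close> are not adjacent, this permutation is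
  dihedral.

  It remains to see that an automorphism fixing every \<open>B i\<close> is the identity. The two paths with one
  chord that omit the sides \<open>i\<close> and \<open>j\<close> could only be swapped, which is excluded by looking at
  common neighbours with two chords; here \<open>n \<ge> 5\<close> is needed. For paths with more chords use
  induction on their number: replacing the first or the last chord by a side gives two neighbours
  with fewer chords, and these determine the path.\<close>

section \<open>Edge sets of paths\<close>

text \<open>Adjacency makes the path graph an induced subgraph of a Johnson graph: its vertices are
  edge sets of size n - 1, and the members of a clique either share n - 2 edges or lie in one set of
  n edges. The number four comes from the first kind: deleting an edge leaves two pieces, and a
  completion joins an end of one piece to an end of the other. Thus n \<ge> 5 serves twice: it makes
  n exceed four, and of two nonadjacent sides it places one at least three steps ahead of the other,
  which gives room for the two-chord path that tells the one-chord paths apart. The obstacle in the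
  final induction is that the number of chords is not visibly a graph invariant. Only having at most
  one chord is, as it means being a boundary path or adjacent to one. The induction therefore first
  bounds the number of chords of the image from below by injectivity, and only then compares the two
  neighbours.\<close>

fun pedges :: "'a list \<Rightarrow> 'a set set" where
  "pedges [] = {}"
| "pedges [x] = {}"
| "pedges (x # y # xs) = insert {x, y} (pedges (y # xs))"

lemma pedges_Cons: "xs \<noteq> [] \<Longrightarrow> pedges (x # xs) = insert {x, hd xs} (pedges xs)"
  by (cases xs) auto

lemma finite_pedges [simp]: "finite (pedges xs)"
  by (induction xs rule: pedges.induct) auto

lemma pedges_append:
  "xs \<noteq> [] \<Longrightarrow> ys \<noteq> [] \<Longrightarrow> pedges (xs @ ys) = insert {last xs, hd ys} (pedges xs \<union> pedges ys)"
  by (induction xs rule: pedges.induct) (auto simp: pedges_Cons)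

lemma pedges_rev [simp]: "pedges (rev xs) = pedges xs"
proof (induction xs)
  case (Cons x xs)
  then show ?case
    by (cases "xs = []") (simp_all add: pedges_append pedges_Cons last_rev insert_commute)
qed simp

lemma in_pedges_subset: "e \<in> pedges xs \<Longrightarrow> e \<subseteq> set xs"
  by (induction xs rule: pedges.induct) auto

lemma pedges_map: "pedges (map f xs) = (`) f ` pedges xs"
  by (induction xs rule: pedges.induct) auto

lemma pedges_conv_nth: "pedges xs = {{xs ! i, xs ! Suc i} | i. Suc i < length xs}"
proof (induction xs rule: pedges.induct)
  case (3 x y xs)
  have "{{(x # y # xs) ! i, (x # y # xs) ! Suc i} | i. Suc i < length (x # y # xs)} =
      insert {x, y} {{(y # xs) ! i, (y # xs) ! Suc i} | i. Suc i < length (y # xs)}" (is "?L = ?R")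
  proof (intro subset_antisym subsetI)
    fix e assume "e \<in> ?L"
    then obtain i where i: "e = {(x # y # xs) ! i, (x # y # xs) ! Suc i}" "Suc i < length (x # y # xs)"
      by blast
    then show "e \<in> ?R" by (cases i) auto
  next
    fix e assume "e \<in> ?R"
    then consider "e = {x, y}" | i where "e = {(y # xs) ! i, (y # xs) ! Suc i}" "Suc i < length (y # xs)"
      by blast
    then show "e \<in> ?L"
    proof cases
      case 1
      then show ?thesis by (intro CollectI exI[of _ 0]) auto
    next
      case (2 i)
      then show ?thesis by (intro CollectI exI[of _ "Suc i"]) auto
    qed
  qed
  then show ?case using 3 by simp
qed auto

lemma pedges_nthI: "Suc i < length xs \<Longrightarrow> {xs ! i, xs ! Suc i} \<in> pedges xs"
  by (auto simp: pedges_conv_nth)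

lemma pedges_nthE:
  assumes "e \<in> pedges xs"
  obtains i where "Suc i < length xs" "e = {xs ! i, xs ! Suc i}"
  using assms by (auto simp: pedges_conv_nth)

lemma pedges_nth_iff:
  assumes "distinct xs" "i < length xs" "j < length xs"
  shows "{xs ! i, xs ! j} \<in> pedges xs \<longleftrightarrow> j = Suc i \<or> i = Suc j"
proof
  assume "{xs ! i, xs ! j} \<in> pedges xs"
  then obtain k where "Suc k < length xs" "{xs ! i, xs ! j} = {xs ! k, xs ! Suc k}"
    by (rule pedges_nthE)
  then show "j = Suc i \<or> i = Suc j"
    using assms by (auto simp: doubleton_eq_iff nth_eq_iff_index_eq)
next
  show "j = Suc i \<or> i = Suc j \<Longrightarrow> {xs ! i, xs ! j} \<in> pedges xs"
    using assms pedges_nthI by (auto simp: insert_commute)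
qed

lemma card_pedges:
  assumes "distinct xs"
  shows "card (pedges xs) = length xs - 1"
  using assms
proof (induction xs rule: pedges.induct)
  case (3 x y xs)
  then have "{x, y} \<notin> pedges (y # xs)" using in_pedges_subset by fastforce
  then show ?case using 3 by simp
qed auto

lemma pedges_doubleton:
  assumes "distinct xs" "e \<in> pedges xs"
  obtains x y where "e = {x, y}" "x \<noteq> y" "x \<in> set xs" "y \<in> set xs"
  using assms
  by (metis pedges_nthE nth_eq_iff_index_eq Suc_lessD n_not_Suc_n nth_mem)

lemma pedges_degree_le_2:
  assumes "distinct xs" "{v, a} \<in> pedges xs" "{v, b} \<in> pedges xs" "{v, c} \<in> pedges xs"
  shows "a = b \<or> a = c \<or> b = c"
proof -
  have mem: "v \<in> set xs" "a \<in> set xs" "b \<in> set xs" "c \<in> set xs"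
    using assms(2-4) in_pedges_subset by blast+
  then obtain i j k l where "i < length xs" "j < length xs" "k < length xs" "l < length xs"
     "v = xs ! i" "a = xs ! j" "b = xs ! k" "c = xs ! l"
    by (metis in_set_conv_nth)
  then show ?thesis using assms by (auto simp: pedges_nth_iff)
qed

text \<open>Membership in \<open>A\<close> has to change somewhere along the list. This cut form is
  how connectedness of paths is used below.\<close>

lemma pedges_connected:
  assumes "set xs \<inter> A \<noteq> {}" "\<not> set xs \<subseteq> A"
  obtains x y where "{x, y} \<in> pedges xs" "x \<in> A" "y \<notin> A"
proof -
  have "\<exists>x y. {x, y} \<in> pedges xs \<and> x \<in> A \<and> y \<notin> A"
    using assms
  proof (induction xs rule: pedges.induct)
    case (3 x y xs)
    show ?case
    proof (cases "x \<in> A \<longleftrightarrow> y \<in> A")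
      case True
      then have "set (y # xs) \<inter> A \<noteq> {}" "\<not> set (y # xs) \<subseteq> A" using "3.prems" by auto
      then show ?thesis using "3.IH" by auto
    next
      case False
      then show ?thesis by (auto simp: insert_commute)
    qed
  qed auto
  then show ?thesis using that by blast
qed

lemma pedges_covers:
  assumes "v \<in> set xs" "length xs \<ge> 2"
  obtains w where "{v, w} \<in> pedges xs"
proof -
  obtain i where i: "i < length xs" "v = xs ! i" using assms by (metis in_set_conv_nth)
  show ?thesis
  proof (cases "Suc i < length xs")
    case True
    then show ?thesis using that pedges_nthI i by blast
  next
    case False
    then obtain j where "i = Suc j" using assms i by (cases i) auto
    then show ?thesis using that[of "xs ! j"] i pedges_nthI[of j xs] by (auto simp: insert_commute)
  qed
qed

text \<open>An inner entry of the list lies on two edges, so \<open>v\<close> is the first or the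
  last entry; in the second case the reversed list serves, as it has the same edges.\<close>

lemma pedges_leaf:
  assumes "distinct xs" "{v, w} \<in> pedges xs" "\<And>e. e \<in> pedges xs \<Longrightarrow> v \<in> e \<Longrightarrow> e = {v, w}"
  obtains ys where "pedges xs = pedges (v # w # ys)" "set xs = set (v # w # ys)" "distinct (v # w # ys)"
proof -
  have mem: "v \<in> set xs" "w \<in> set xs" using assms(2) in_pedges_subset by blast+
  then obtain i j where ij: "i < length xs" "j < length xs" "v = xs ! i" "w = xs ! j"
    by (metis in_set_conv_nth)
  then have *: "j = Suc i \<or> i = Suc j" using assms by (auto simp: pedges_nth_iff)
  have **: "k = j" if "k < length xs" "k = Suc i \<or> i = Suc k" for k
  proof -
    have "{v, xs ! k} \<in> pedges xs" using that ij assms(1) by (auto simp: pedges_nth_iff)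
    from assms(3)[OF this] show ?thesis
      using ij that assms(1) by (auto simp: doubleton_eq_iff nth_eq_iff_index_eq)
  qed
  have "\<exists>ys. pedges xs = pedges (v # w # ys) \<and> set xs = set (v # w # ys) \<and> distinct (v # w # ys)"
    using *
  proof
    assume j: "j = Suc i"
    have "i = 0"
    proof (rule ccontr)
      assume "i \<noteq> 0"
      then obtain k where "i = Suc k" by (cases i) auto
      then show False using **[of k] j ij by auto
    qed
    with j ij have "xs = v # w # drop 2 xs"
      by (metis Cons_nth_drop_Suc One_nat_def Suc_1 drop0)
    then show ?thesis using assms(1) by metis
  next
    assume i: "i = Suc j"
    have "Suc i = length xs"
      using **[of "Suc i"] i ij by (metis Suc_lessI n_not_Suc_n le_imp_less_Suc less_or_eq_imp_le less_Suc_eq_le Suc_n_not_le_n)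
    then have "xs = take j xs @ [w, v]"
      using i ij by (metis append_take_drop_id Cons_nth_drop_Suc drop_all order_refl)
    then have "rev xs = v # w # rev (take j xs)" by (metis rev.simps rev_append append_Cons append_Nil rev_swap rev_singleton_conv)
    then show ?thesis using assms(1) by (metis pedges_rev set_rev distinct_rev)
  qed
  then show ?thesis using that by blast
qed

section \<open>Non-crossing paths of a convex polygon\<close>

text \<open>Adjacency of the path graph without the condition that both sets are simple spanning
  paths, and for edges of any type; among finite sets of equal size it is adjacency in a Johnson
  graph.\<close>

definition exchange :: "'a set \<Rightarrow> 'a set \<Rightarrow> bool" where
  "exchange S T \<longleftrightarrow> (\<exists>e\<in>S. \<exists>f. f \<notin> S \<and> T = insert f (S - {e}))"

lemma exchangeI: "e \<in> S \<Longrightarrow> f \<notin> S \<Longrightarrow> T = insert f (S - {e}) \<Longrightarrow> exchange S T"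
  by (auto simp: exchange_def)

lemma exchangeE:
  assumes "exchange S T"
  obtains e f where "e \<in> S" "f \<notin> S" "T = insert f (S - {e})" "e \<notin> T" "f \<in> T" "S = insert e (T - {f})"
proof -
  obtain e f where "e \<in> S" "f \<notin> S" "T = insert f (S - {e})"
    using assms by (auto simp: exchange_def)
  moreover from this have "e \<notin> T" "f \<in> T" "S = insert e (T - {f})" by auto
  ultimately show ?thesis using that by blast
qed

locale ngon =
  fixes n :: nat
  assumes n_ge: "n \<ge> 5"
begin

section \<open>Residues modulo n and their integer representatives\<close>

abbreviation N :: int where "N \<equiv> int n"

lemma N_ge: "N \<ge> 5"
  using n_ge by simp

definition r :: "int \<Rightarrow> int" where "r x = x mod N"

definition Z :: "int set" where "Z = {0..<N}"

lemma r_in_Z [simp]: "r x \<in> Z"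
  using N_ge by (simp add: r_def Z_def)

lemma r_id: "x \<in> Z \<Longrightarrow> r x = x"
  by (simp add: r_def Z_def)

lemma r_add_mult [simp]: "r (x + m * N) = r x" "r (x + N) = r x" "r (x - N) = r x"
  by (simp_all add: r_def)

lemma finite_Z [simp]: "finite Z" and card_Z [simp]: "card Z = n"
  by (simp_all add: Z_def)

lemma r_eqE:
  assumes "r x = r y"
  obtains m where "x = y + m * N"
proof -
  have "N dvd x - y" using assms by (simp add: r_def mod_eq_dvd_iff)
  then obtain m where "x - y = N * m" by (auto simp: dvd_def)
  then show ?thesis using that[of m] by (simp add: algebra_simps)
qed

lemma r_eqD:
  assumes "r x = r y" "x < y + N" "y < x + N"
  shows "x = y"
proof -
  obtain m where m: "x = y + m * N" using assms(1) by (rule r_eqE)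
  have "m < 1"
  proof (rule ccontr)
    assume "\<not> m < 1"
    then have "1 * N \<le> m * N" by (intro mult_right_mono) auto
    then show False using m assms(2) by linarith
  qed
  moreover have "m > -1"
  proof (rule ccontr)
    assume "\<not> m > -1"
    then have "m * N \<le> (-1) * N" by (intro mult_right_mono) auto
    then show False using m assms(3) by linarith
  qed
  ultimately show ?thesis using m by simp
qed

lemma r_repE:
  assumes "v \<in> Z"
  obtains x where "a \<le> x" "x < a + N" "v = r x"
proof
  show "a \<le> a + (v - a) mod N" using N_ge by simp
  show "a + (v - a) mod N < a + N" using N_ge by simp
  have "(a + (v - a) mod N) mod N = v mod N" by (simp add: mod_simps)
  then show "v = r (a + (v - a) mod N)" using r_id[OF assms] by (simp add: r_def)
qed

lemma r_rep_gtE: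
  assumes "v \<in> Z" "v \<noteq> r a"
  obtains x where "a < x" "x < a + N" "v = r x"
proof -
  obtain x where "a \<le> x" "x < a + N" "v = r x" using r_repE[OF assms(1)] by blast
  then show ?thesis using that[of x] assms(2) by (cases "a = x") auto
qed

section \<open>The sides of the polygon\<close>

definition h :: "int \<Rightarrow> int set" where "h i = {r i, r (i + 1)}"

definition H :: "int set set" where "H = range h"

lemma h_in_H [simp]: "h i \<in> H"
  by (simp add: H_def)

lemma h_add [simp]: "h (x + m * N) = h x" "h (x + N) = h x"
proof -
  show "h (x + m * N) = h x"
    using r_add_mult(1)[of "x + 1" m] by (simp add: h_def algebra_simps)
  show "h (x + N) = h x"
    using r_add_mult(2)[of "x + 1"] by (simp add: h_def algebra_simps)
qed

lemma r_neq_suc: "r i \<noteq> r (i + 1)"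
  using r_eqD[of i "i + 1"] N_ge by auto

lemma r_neq_suc2: "r i \<noteq> r (i + 2)"
  using r_eqD[of i "i + 2"] N_ge by auto

lemma h_eq_iff: "h i = h j \<longleftrightarrow> r i = r j"
proof
  assume "h i = h j"
  then have "r i = r j \<and> r (i + 1) = r (j + 1) \<or> r i = r (j + 1) \<and> r (i + 1) = r j"
    by (simp add: h_def doubleton_eq_iff)
  then show "r i = r j"
  proof
    \<comment> \<open>The crosswise match of the two pairs would identify \<open>j\<close> and
      \<open>j + 2\<close> modulo \<open>n\<close>.\<close>
    assume *: "r i = r (j + 1) \<and> r (i + 1) = r j"
    then obtain m where "i = j + 1 + m * N" by (auto elim: r_eqE)
    then have "i + 1 = (j + 2) + m * N" by simp
    then have "r (i + 1) = r (j + 2)" by (metis r_add_mult(1))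
    then show ?thesis using * r_neq_suc2 by auto
  qed simp
next
  assume "r i = r j"
  then obtain m where "i = j + m * N" by (rule r_eqE)
  then show "h i = h j" by simp
qed

lemma H_eq: "H = h ` {a..<a + N}"
proof -
  have "h i \<in> h ` {a..<a + N}" for i
  proof -
    obtain x where "a \<le> x" "x < a + N" "r i = r x" using r_repE[of "r i" a] by auto
    then have "h i = h x" "x \<in> {a..<a + N}" by (auto simp: h_eq_iff)
    then show ?thesis by blast
  qed
  then show ?thesis by (auto simp: H_def)
qed

lemma inj_on_h: "b \<le> a + N \<Longrightarrow> inj_on h {a..<b}"
  by (rule inj_onI) (auto simp: h_eq_iff intro: r_eqD)

lemma finite_H [simp]: "finite H" and card_H [simp]: "card H = n"
proof -
  show "finite H" by (simp add: H_eq[of 0])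
  show "card H = n" using inj_on_h[of N 0] by (simp add: H_eq[of 0] card_image)
qed

lemma hE:
  assumes "e \<in> H"
  obtains i where "a \<le> i" "i < a + N" "e = h i"
  using assms by (auto simp: H_eq[of a])

lemma h_containing:
  assumes "e \<in> H" "r t \<in> e"
  shows "e = h t \<or> e = h (t - 1)"
proof -
  obtain i where i: "e = h i" using assms by (auto simp: H_def)
  then have "r t = r i \<or> r t = r (i + 1)" using assms by (auto simp: h_def)
  then show ?thesis
  proof
    assume "r t = r i"
    then show ?thesis using i by (simp add: h_eq_iff)
  next
    assume "r t = r (i + 1)"
    then obtain m where "t = i + 1 + m * N" by (rule r_eqE)
    then have "t - 1 = i + m * N" by simp
    then show ?thesis using i by (metis h_add(1))
  qed
qed

lemma hull_neighbour:
  assumes "{r t, s} \<in> H"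
  shows "s = r (t + 1) \<or> s = r (t - 1)"
  using h_containing[OF assms] r_neq_suc[of t] r_neq_suc[of "t - 1"]
  by (auto simp: h_def doubleton_eq_iff)

lemma hull_degree_le_2:
  assumes "t \<in> Z" "{t, a} \<in> H" "{t, b} \<in> H" "{t, c} \<in> H"
  shows "a = b \<or> a = c \<or> b = c"
  using assms hull_neighbour[of t] r_id[of t] by metis

text \<open>Residues are represented by arbitrary integers, which makes the invariance of crossing under
  rotations and reflections evident.\<close>

definition cross :: "int set \<Rightarrow> int set \<Rightarrow> bool" where
  "cross e f \<longleftrightarrow> (\<exists>x y z w. x < y \<and> y < z \<and> z < w \<and> w < x + N \<and> e = {r x, r z} \<and> f = {r y, r w})"

lemma crossI: "x < y \<Longrightarrow> y < z \<Longrightarrow> z < w \<Longrightarrow> w < x + N \<Longrightarrow> cross {r x, r z} {r y, r w}"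
  by (auto simp: cross_def)

lemma cross_sym:
  assumes "cross e f"
  shows "cross f e"
proof -
  obtain x y z w where "x < y" "y < z" "z < w" "w < x + N" "e = {r x, r z}" "f = {r y, r w}"
    using assms by (auto simp: cross_def)
  then show ?thesis using crossI[of y z w "x + N"] by (simp add: insert_commute)
qed

text \<open>The cyclic quadruple may start at either end point of \<open>e\<close>. If
  \<open>a\<close> represents the third point, \<open>x < y < z < w\<close> is rotated to
  \<open>z < w < x + N < y + N\<close>; adding a multiple of \<open>N\<close> moves the start to
  \<open>a\<close>.\<close>

lemma crossE_at:
  assumes "cross e f" "r a \<in> e"
  obtains y z w where "a < y" "y < z" "z < w" "w < a + N" "e = {r a, r z}" "f = {r y, r w}"
proof -
  obtain x y z w where *: "x < y" "y < z" "z < w" "w < x + N" "e = {r x, r z}" "f = {r y, r w}"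
    using assms by (auto simp: cross_def)
  then consider "r a = r x" | "r a = r z" using assms(2) by auto
  then show ?thesis
  proof cases
    case 1
    then obtain m where "a = x + m * N" by (rule r_eqE)
    then show ?thesis using that[of "y + m * N" "z + m * N" "w + m * N"] * 1 by auto
  next
    case 2
    then obtain m where "a = z + m * N" by (rule r_eqE)
    then show ?thesis
      using that[of "w + m * N" "x + N + m * N" "y + N + m * N"] * 2 by (auto simp: insert_commute)
  qed
qed

lemma cross_disjoint:
  assumes "cross e f"
  shows "e \<inter> f = {}"
proof -
  obtain x y z w where "x < y" "y < z" "z < w" "w < x + N" "e = {r x, r z}" "f = {r y, r w}"
    using assms by (auto simp: cross_def)
  then show ?thesis using r_eqD[of x y] r_eqD[of x w] r_eqD[of z y] r_eqD[of z w] by auto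
qed

lemma not_cross_hull:
  assumes "e \<in> H"
  shows "\<not> cross e f" "\<not> cross f e"
proof -
  show *: "\<not> cross e f"
  proof
    assume c: "cross e f"
    obtain i where i: "e = h i" using assms by (auto simp: H_def)
    obtain y z w where y: "i < y" "y < z" "z < w" "w < i + N" "e = {r i, r z}" "f = {r y, r w}"
      using crossE_at[OF c, of i] i by (auto simp: h_def)
    then have "r z = r (i + 1)" using i r_neq_suc[of i] by (auto simp: h_def doubleton_eq_iff)
    then have "z = i + 1" using y r_eqD[of z "i + 1"] by simp
    then show False using y by auto
  qed
  then show "\<not> cross f e" using cross_sym by blast
qed

text \<open>For \<open>a < b < a + N\<close> these are the vertices strictly on one side of the
  chord from \<open>r a\<close> to \<open>r b\<close>.\<close>

definition arc :: "int \<Rightarrow> int \<Rightarrow> int set" where "arc a b = r ` {a<..<b}"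

lemma in_arcI: "a < y \<Longrightarrow> y < b \<Longrightarrow> r y \<in> arc a b"
  by (auto simp: arc_def)

lemma not_in_arcI:
  assumes "b \<le> y" "y \<le> a + N"
  shows "r y \<notin> arc a b"
proof
  assume "r y \<in> arc a b"
  then obtain x where "r y = r x" "a < x" "x < b" by (auto simp: arc_def)
  then show False using r_eqD[of y x] assms by auto
qed

lemma not_in_arcE:
  assumes "v \<in> Z" "v \<notin> arc a b" "v \<noteq> r a" "v \<noteq> r b"
  obtains y where "b < y" "y < a + N" "v = r y"
proof -
  obtain y where y: "a < y" "y < a + N" "v = r y" using r_rep_gtE assms by blast
  then have "\<not> y < b" using assms in_arcI by blast
  moreover have "y \<noteq> b" using assms y by auto
  ultimately show ?thesis using that[of y] y by auto
qed

lemma same_side: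
  assumes "\<not> cross {r a, r b} {v, w}" "v \<in> Z" "w \<in> Z"
    "v \<notin> {r a, r b}" "w \<notin> {r a, r b}" "v \<in> arc a b"
  shows "w \<in> arc a b"
proof (rule ccontr)
  assume "w \<notin> arc a b"
  then obtain y where "b < y" "y < a + N" "w = r y" using not_in_arcE[of w a b] assms by auto
  moreover obtain x where "a < x" "x < b" "v = r x" using assms by (auto simp: arc_def)
  ultimately show False using assms(1) crossI[of a x b y] by auto
qed

definition simple :: "int set set \<Rightarrow> bool" where
  "simple S \<longleftrightarrow> (\<forall>e\<in>S. \<forall>f\<in>S. \<not> cross e f)"

text \<open>The path avoids the ends of the chord, so an edge leading from \<open>arc a b\<close> to
  the other side would have to cross it.\<close>

lemma path_same_side:
  assumes "{r a, r b} \<in> S" "simple S" "pedges ys \<subseteq> S" "set ys \<subseteq> Z - {r a, r b}"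
    "set ys \<inter> arc a b \<noteq> {}"
  shows "set ys \<subseteq> arc a b"
proof (rule ccontr)
  assume "\<not> ?thesis"
  then obtain x y where xy: "{x, y} \<in> pedges ys" "x \<in> arc a b" "y \<notin> arc a b"
    using pedges_connected assms(5) by metis
  then have "\<not> cross {r a, r b} {x, y}" using assms by (auto simp: simple_def)
  moreover have "x \<in> set ys" "y \<in> set ys" using in_pedges_subset[OF xy(1)] by auto
  ultimately show False using same_side[of a b x y] xy assms(4) by blast
qed

lemma chordE:
  assumes "v \<in> Z" "w \<in> Z" "v \<noteq> w" "{v, w} \<notin> H"
  obtains a b where "v = r a" "w = r b" "a + 2 \<le> b" "b \<le> a + N - 2"
proof -
  have v: "v = r v" using assms by (simp add: r_id)
  obtain b where b: "v < b" "b < v + N" "w = r b" using r_rep_gtE[of w v] assms v by auto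
  have "b \<noteq> v + 1" using assms(4) b v h_in_H[of v] by (auto simp: h_def)
  moreover have "b \<noteq> v + N - 1"
    using assms(4) b v h_in_H[of b] by (auto simp: h_def insert_commute)
  ultimately show ?thesis using that[of v b] v b by auto
qed

section \<open>Simple spanning paths of the polygon\<close>

definition SP :: "int set set set" where
  "SP = {pedges xs | xs. distinct xs \<and> set xs = Z \<and> simple (pedges xs)}"

lemma SP_I: "distinct xs \<Longrightarrow> set xs = Z \<Longrightarrow> simple (pedges xs) \<Longrightarrow> S = pedges xs \<Longrightarrow> S \<in> SP"
  by (auto simp: SP_def)

lemma SP_E:
  assumes "S \<in> SP"
  obtains xs where "S = pedges xs" "distinct xs" "set xs = Z" "length xs = n" "simple S"
proof -
  obtain xs where *: "S = pedges xs" "distinct xs" "set xs = Z" "simple S"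
    using assms by (auto simp: SP_def)
  moreover have "length xs = n" using * by (metis card_Z distinct_card)
  ultimately show ?thesis using that by blast
qed

lemma SP_simple: "S \<in> SP \<Longrightarrow> e \<in> S \<Longrightarrow> f \<in> S \<Longrightarrow> \<not> cross e f"
  by (elim SP_E) (auto simp: simple_def)

lemma SP_finite: "S \<in> SP \<Longrightarrow> finite S"
  by (auto elim: SP_E)

lemma SP_card: "S \<in> SP \<Longrightarrow> card S = n - 1"
  by (auto elim!: SP_E simp: card_pedges)

lemma SP_doubleton:
  assumes "S \<in> SP" "e \<in> S"
  obtains x y where "e = {x, y}" "x \<noteq> y" "x \<in> Z" "y \<in> Z"
  using assms by (auto elim!: SP_E elim: pedges_doubleton)

lemma SP_edge_subset:
  assumes "S \<in> SP" "e \<in> S"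
  shows "e \<subseteq> Z"
proof -
  obtain xs where "S = pedges xs" "set xs = Z" using SP_E[OF assms(1)] by metis
  then show ?thesis using in_pedges_subset[of e xs] assms(2) by simp
qed

lemma SP_degree_le_2:
  assumes "S \<in> SP" "{v, a} \<in> S" "{v, b} \<in> S" "{v, c} \<in> S"
  shows "a = b \<or> a = c \<or> b = c"
  using assms by (auto elim!: SP_E dest: pedges_degree_le_2)

lemma SP_connected:
  assumes "S \<in> SP" "v \<in> Z" "v \<in> A" "w \<in> Z" "w \<notin> A"
  obtains x y where "{x, y} \<in> S" "x \<in> A" "y \<notin> A"
proof -
  obtain xs where xs: "S = pedges xs" "set xs = Z" using SP_E[OF assms(1)] by metis
  then have "set xs \<inter> A \<noteq> {}" "\<not> set xs \<subseteq> A" using assms by auto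
  then show ?thesis using that pedges_connected xs by metis
qed

lemma SP_covers:
  assumes "S \<in> SP" "v \<in> Z"
  obtains w where "{v, w} \<in> S"
proof -
  obtain xs where "S = pedges xs" "set xs = Z" "length xs = n" using SP_E[OF assms(1)] by metis
  then show ?thesis using that pedges_covers[of v xs] assms n_ge by auto
qed

lemma leaf_hull:
  assumes S: "S \<in> SP" and vw: "{v, w} \<in> S" and leaf: "\<And>e. e \<in> S \<Longrightarrow> v \<in> e \<Longrightarrow> e = {v, w}"
  shows "{v, w} \<in> H"
proof (rule ccontr)
  assume nH: "{v, w} \<notin> H"
  obtain xs where xs: "S = pedges xs" "distinct xs" "set xs = Z" "simple S"
    using S by (rule SP_E)
  obtain ys where ys: "S = pedges (v # w # ys)" "Z = set (v # w # ys)" "distinct (v # w # ys)"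
    using pedges_leaf[OF xs(2), of v w] vw leaf xs by metis
  obtain a b where ab: "v = r a" "w = r b" "a + 2 \<le> b" "b \<le> a + N - 2"
    using chordE[of v w] ys nH by auto
  have sub: "set ys \<subseteq> Z - {r a, r b}" using ys ab by auto
  have "r (a + 1) \<noteq> r a" "r (a + 1) \<noteq> r b" "r (b + 1) \<noteq> r a" "r (b + 1) \<noteq> r b"
    using r_eqD[of "a + 1" a] r_eqD[of "a + 1" b] r_eqD[of "b + 1" a] r_eqD[of "b + 1" b] ab N_ge by auto
  moreover have "r (a + 1) \<in> set (v # w # ys)" "r (b + 1) \<in> set (v # w # ys)"
    unfolding ys(2)[symmetric] by auto
  \<comment> \<open>The rest \<open>ys\<close> of the path meets both sides of the chord:
    \<open>r (a + 1)\<close> lies on one and \<open>r (b + 1)\<close> on the other.\<close>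
  ultimately have mem: "r (a + 1) \<in> set ys" "r (b + 1) \<in> set ys" using ab by auto
  have "r (a + 1) \<in> arc a b" using ab by (intro in_arcI) auto
  moreover have "r (b + 1) \<notin> arc a b" using ab by (intro not_in_arcI) auto
  moreover have "pedges ys \<subseteq> S" using ys by (cases ys) auto
  ultimately show False
    using path_same_side[OF _ xs(4) _ sub] vw mem ab by auto
qed

text \<open>Sides cross nothing, so only the two chords matter; \<open>c = d\<close> covers sets
  with a single chord. Writing the chords as pairs ensures that they are nonempty, so that neither
  crosses itself.\<close>

lemma simple_two_chords:
  assumes "S \<subseteq> insert c (insert d H)" "\<not> cross c d"
    "c = {r x, r y}" "d = {r z, r w}"
  shows "simple S"
proof -
  have "\<not> cross c c" "\<not> cross d d" using cross_disjoint[of c c] cross_disjoint[of d d] assms by auto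
  then show ?thesis using assms(1,2) not_cross_hull cross_sym unfolding simple_def by blast
qed

section \<open>Boundary paths and paths with one or two chords\<close>

lemma pedges_consecutive: "pedges (map r [a..b]) = h ` {a..<b}"
proof (induction "nat (b - a)" arbitrary: a)
  case 0
  then show ?case by (cases "a = b") auto
next
  case (Suc k)
  then have *: "a < b" by auto
  then have "{a..<b} = insert a {a + 1..<b}" by auto
  moreover have "[a + 1..b] \<noteq> []" "hd [a + 1..b] = a + 1" using * by (auto simp: upto_rec1)
  moreover have "pedges (map r [a + 1..b]) = h ` {a + 1..<b}" using Suc by (intro Suc.hyps(1)) auto
  ultimately show ?case using * by (simp add: upto_rec1[of a b] pedges_Cons hd_map h_def)
qed

lemma distinct_map_r: "b < a + N \<Longrightarrow> distinct (map r [a..b])"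
  by (auto simp: distinct_map inj_on_def intro: r_eqD)

lemma Z_eq: "Z = r ` {a<..a + N}"
proof
  show "Z \<subseteq> r ` {a<..a + N}"
  proof
    fix v assume "v \<in> Z"
    then obtain x where "a + 1 \<le> x" "x < a + 1 + N" "v = r x" using r_repE[of v "a + 1"] by blast
    then show "v \<in> r ` {a<..a + N}" by auto
  qed
qed auto

lemma last_upto: "a \<le> b \<Longrightarrow> last [a..b] = b"
  by (simp add: upto_rec2)

lemma hd_upto: "a \<le> b \<Longrightarrow> hd [a..b] = a"
  by (simp add: upto_rec1)

definition B :: "int \<Rightarrow> int set set" where "B i = H - {h i}"

lemma H_remove: "H - {h i} = h ` {i + 1..<i + N}"
proof -
  have "{i..<i + N} = insert i {i + 1..<i + N}" using N_ge by auto
  moreover have "h i \<notin> h ` {i + 1..<i + N}" by (auto simp: h_eq_iff dest!: r_eqD)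
  ultimately show ?thesis by (auto simp: H_eq[of i])
qed

lemma H_remove2:
  assumes "i < j" "j < i + N"
  shows "H - {h i, h j} = h ` {i + 1..<j} \<union> h ` {j + 1..<i + N}"
proof -
  have "{i + 1..<i + N} = insert j ({i + 1..<j} \<union> {j + 1..<i + N})" using assms by auto
  moreover have "h j \<notin> h ` {i + 1..<j}" "h j \<notin> h ` {j + 1..<i + N}"
    using assms by (auto simp: h_eq_iff dest!: r_eqD)
  ultimately have "h ` {i + 1..<i + N} - {h j} = h ` {i + 1..<j} \<union> h ` {j + 1..<i + N}" by auto
  moreover have "H - {h i, h j} = H - {h i} - {h j}" by blast
  ultimately show ?thesis by (simp only: H_remove)
qed

text \<open>These are the two pieces of the boundary that remain when the sides \<open>h i\<close>
  and \<open>h j\<close> are deleted; the paths below arise by joining them at their ends.\<close>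

lemma two_arcs:
  assumes "i < j" "j < i + N"
  shows "distinct (map r [i + 1..j] @ map r [j + 1..i + N])"
    and "r ` {i + 1..j} \<union> r ` {j + 1..i + N} = Z"
proof -
  have "[i + 1..j] @ [j + 1..i + N] = [i + 1..i + N]" using assms by (intro upto_split2[symmetric]) auto
  then have "map r [i + 1..j] @ map r [j + 1..i + N] = map r [i + 1..i + N]" by (metis map_append)
  then show "distinct (map r [i + 1..j] @ map r [j + 1..i + N])" by (simp add: distinct_map_r)
  have "{i<..i + N} = {i + 1..j} \<union> {j + 1..i + N}" using assms by auto
  then show "r ` {i + 1..j} \<union> r ` {j + 1..i + N} = Z" by (simp add: Z_eq[of i] image_Un)
qed

lemma B_in_SP: "B i \<in> SP"
proof (rule SP_I)
  show "distinct (map r [i + 1..i + N])" by (simp add: distinct_map_r)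
  have "{i + 1..i + N} = {i<..i + N}" by auto
  then show "set (map r [i + 1..i + N]) = Z" using Z_eq[of i] by simp
  show "B i = pedges (map r [i + 1..i + N])"
    by (simp add: B_def H_remove pedges_consecutive)
  show "simple (pedges (map r [i + 1..i + N]))"
    unfolding pedges_consecutive simple_def using not_cross_hull(1) by auto
qed

text \<open>\<open>Dm i j\<close> and \<open>Dp i j\<close> are the only simple paths that have exactly one chord and omit
  the sides \<open>h i\<close> and \<open>h j\<close>.\<close>

definition Dm :: "int \<Rightarrow> int \<Rightarrow> int set set" where
  "Dm i j = insert {r i, r j} (H - {h i, h j})"

definition Dp :: "int \<Rightarrow> int \<Rightarrow> int set set" where
  "Dp i j = insert {r (i + 1), r (j + 1)} (H - {h i, h j})"

lemma Dm_in_SP: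
  assumes "i < j" "j < i + N"
  shows "Dm i j \<in> SP"
proof (rule SP_I)
  \<comment> \<open>The first arc ends in \<open>j\<close> and the reversed second one starts with
    \<open>i + N\<close>, a representative of \<open>i\<close>.\<close>
  let ?xs = "map r [i + 1..j] @ rev (map r [j + 1..i + N])"
  show "distinct ?xs" using two_arcs(1)[OF assms] by auto
  show "set ?xs = Z" using two_arcs(2)[OF assms] by simp
  show *: "Dm i j = pedges ?xs"
    using assms by (simp add: Dm_def H_remove2 pedges_append pedges_consecutive last_map hd_rev last_upto
        insert_commute flip: rev_map)
  show "simple (pedges ?xs)" unfolding *[symmetric]
    by (rule simple_two_chords[of _ "{r i, r j}" "{r i, r j}" i j i j])
      (auto simp: Dm_def dest: cross_disjoint)
qed

lemma Dp_in_SP: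
  assumes "i < j" "j < i + N"
  shows "Dp i j \<in> SP"
proof (rule SP_I)
  \<comment> \<open>Here the first arc is the reversed one, so that \<open>i + 1\<close> is joined
    to \<open>j + 1\<close>.\<close>
  let ?xs = "rev (map r [i + 1..j]) @ map r [j + 1..i + N]"
  show "distinct ?xs" using two_arcs(1)[OF assms] by auto
  show "set ?xs = Z" using two_arcs(2)[OF assms] by simp
  show *: "Dp i j = pedges ?xs"
    using assms by (simp add: Dp_def H_remove2 pedges_append pedges_consecutive hd_map last_rev hd_upto
        insert_commute flip: rev_map)
  show "simple (pedges ?xs)" unfolding *[symmetric]
    by (rule simple_two_chords[of _ "{r (i + 1), r (j + 1)}" "{r (i + 1), r (j + 1)}" "i + 1" "j + 1" "i + 1" "j + 1"])
      (auto simp: Dp_def dest: cross_disjoint)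
qed

text \<open>A common neighbour of \<open>Dm i j\<close> and \<open>Dp i (j - 1)\<close>.\<close>

definition two_chord_path :: "int \<Rightarrow> int \<Rightarrow> int set set" where
  "two_chord_path i j = insert {r i, r j} (insert {r (i + 1), r j} (H - {h i, h j, h (j - 1)}))"

lemma two_chord_path_in_SP:
  assumes "i + 2 \<le> j" "j < i + N"
  shows "two_chord_path i j \<in> SP"
proof (rule SP_I)
  \<comment> \<open>The path descends from \<open>j - 1\<close> to \<open>i + 1\<close>, takes the
    chord to \<open>j\<close>, then the chord to \<open>i\<close>, represented by
    \<open>i + N\<close>, and descends to \<open>j + 1\<close>.\<close>
  let ?xs = "(rev (map r [i + 1..j - 1]) @ [r j]) @ rev (map r [j + 1..i + N])"
  have *: "[i + 1..j] = [i + 1..j - 1] @ [j]" using assms by (simp add: upto_rec2)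
  have "distinct (map r ([i + 1..j - 1] @ [j]) @ map r [j + 1..i + N])"
    using two_arcs(1)[of i j] assms unfolding *[symmetric] by simp
  then show "distinct ?xs" by auto
  have **: "{i + 1..j} = insert j {i + 1..j - 1}" using assms by auto
  show "set ?xs = Z" using two_arcs(2)[of i j] assms by (simp add: **)
  have "{i + 1..<j} = insert (j - 1) {i + 1..<j - 1}" using assms by auto
  moreover have "h (j - 1) \<notin> h ` {i + 1..<j - 1}" "h (j - 1) \<notin> h ` {j + 1..<i + N}"
    using assms by (auto simp: h_eq_iff dest!: r_eqD)
  ultimately have "h ` {i + 1..<j} \<union> h ` {j + 1..<i + N} - {h (j - 1)} =
      h ` {i + 1..<j - 1} \<union> h ` {j + 1..<i + N}" by auto
  moreover have "H - {h i, h j, h (j - 1)} = H - {h i, h j} - {h (j - 1)}" by blast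
  ultimately have "H - {h i, h j, h (j - 1)} = h ` {i + 1..<j - 1} \<union> h ` {j + 1..<i + N}"
    using H_remove2[of i j] assms by simp
  then show eq: "two_chord_path i j = pedges ?xs"
    using assms
    by (simp add: two_chord_path_def pedges_append pedges_Cons pedges_consecutive last_rev hd_map hd_upto last_map hd_rev last_upto
        insert_commute flip: rev_map)
  show "simple (pedges ?xs)" unfolding eq[symmetric]
    by (rule simple_two_chords[of _ "{r i, r j}" "{r (i + 1), r j}" i j "i + 1" "j"])
      (auto simp: two_chord_path_def dest: cross_disjoint)
qed

text \<open>The chord has to reconnect the two arcs left by deleting \<open>h i\<close> and
  \<open>h j\<close>, and it can do so only at their ends, because inner vertices of an arc already
  have degree two. If the deleted sides shared a vertex, this vertex would be a leaf on the chord,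
  against \<open>leaf_hull\<close>.\<close>

lemma one_chord_path:
  assumes T: "T \<in> SP" and eq: "T = insert c (H - {h i, h j})" and c: "c \<notin> H" and ij: "i < j" "j < i + N"
  shows "i + 2 \<le> j \<and> j \<le> i + N - 2 \<and> (T = Dm i j \<or> T = Dp i j)"
proof -
  have isolated: False if iso: "\<And>e. e \<in> H \<Longrightarrow> v \<in> e \<Longrightarrow> e \<in> {h i, h j}" and v: "v \<in> Z" for v
  proof -
    obtain w where w: "{v, w} \<in> T" using SP_covers[OF T v] by blast
    have *: "e = c" if "e \<in> T" "v \<in> e" for e using that iso[of e] eq by auto
    then have "{v, w} \<in> H" using w by (intro leaf_hull[OF T w]) auto
    then show False using *[OF w] c by auto
  qed
  have "j \<noteq> i + 1"
  proof
    assume "j = i + 1"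
    then have "e \<in> {h i, h j}" if "e \<in> H" "r j \<in> e" for e using h_containing[OF that] by auto
    then show False using isolated[of "r j"] by simp
  qed
  moreover have "j \<noteq> i + N - 1"
  proof
    assume "j = i + N - 1"
    then have "j = i - 1 + N" by simp
    then have "h j = h (i - 1)" by (simp only: h_add)
    then have "e \<in> {h i, h j}" if "e \<in> H" "r i \<in> e" for e using h_containing[OF that] by auto
    then show False using isolated[of "r i"] by simp
  qed
  ultimately have ij': "i + 2 \<le> j" "j \<le> i + N - 2" using ij by auto
  \<comment> \<open>With the open bounds \<open>i\<close> and \<open>j + 1\<close> this arc consists
    of the vertices \<open>i + 1\<close> to \<open>j\<close>. Some edge of \<open>T\<close> leaves
    it, and the remaining sides do not.\<close>
  have "r j \<in> arc i (j + 1)" "r (j + 1) \<notin> arc i (j + 1)"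
    using ij' by (simp_all add: in_arcI not_in_arcI)
  then obtain x y where xy: "{x, y} \<in> T" "x \<in> arc i (j + 1)" "y \<notin> arc i (j + 1)"
    using SP_connected[OF T, of "r j" "arc i (j + 1)" "r (j + 1)"] by auto
  have c_eq: "c = {x, y}"
  proof (rule ccontr)
    assume "c \<noteq> {x, y}"
    then have "{x, y} \<in> H - {h i, h j}" using xy eq by auto
    then obtain t where t: "{x, y} = h t" "t \<in> {i + 1..<j} \<union> {j + 1..<i + N}"
      using H_remove2[OF ij] by auto
    show False
    proof (cases "t < j")
      case True
      then have "r t \<in> arc i (j + 1)" "r (t + 1) \<in> arc i (j + 1)" using t by (simp_all add: in_arcI)
      then show False using t xy by (auto simp: h_def doubleton_eq_iff)
    next
      case False
      then have "r t \<notin> arc i (j + 1)" "r (t + 1) \<notin> arc i (j + 1)" using t by (simp_all add: not_in_arcI)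
      then show False using t xy by (auto simp: h_def doubleton_eq_iff)
    qed
  qed
  \<comment> \<open>A vertex with both of its sides in \<open>T\<close> cannot also be an end of the
    chord.\<close>
  have mid: False if "v = r s" "{v, w} = c" "h s \<in> T" "h (s - 1) \<in> T" for v w s
  proof -
    have "{v, r (s + 1)} \<in> T" "{v, r (s - 1)} \<in> T" "{v, w} \<in> T"
      using that eq by (auto simp: h_def insert_commute)
    moreover have "r (s + 1) \<noteq> r (s - 1)" using r_neq_suc2[of "s - 1"] by (simp add: algebra_simps)
    ultimately have "w = r (s + 1) \<or> w = r (s - 1)" using SP_degree_le_2[OF T] by metis
    then have "c = h s \<or> c = h (s - 1)" using that by (auto simp: h_def insert_commute)
    then show False using c by auto
  qed
  have hT: "h s \<in> T" if "s \<in> {i + 1..<j} \<union> {j + 1..<i + N}" for s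
    using that H_remove2[OF ij] eq by blast
  obtain s where s: "x = r s" "i < s" "s \<le> j" using xy(2) by (auto simp: arc_def)
  have s': "s = i + 1 \<or> s = j"
  proof (rule ccontr)
    assume "\<not> ?thesis"
    then have "h s \<in> T" "h (s - 1) \<in> T" using s hT[of s] hT[of "s - 1"] by simp_all
    then show False using mid[of x s y] s(1) c_eq by simp
  qed
  have "y \<in> Z" using SP_edge_subset[OF T xy(1)] by simp
  then obtain t where t: "y = r t" "i + 1 \<le> t" "t < i + 1 + N" using r_repE[of y "i + 1"] by blast
  have tj: "t > j"
  proof (rule ccontr)
    assume "\<not> t > j"
    then have "r t \<in> arc i (j + 1)" using t by (intro in_arcI) simp_all
    then show False using t xy(3) by simp
  qed
  have t': "t = j + 1 \<or> t = i + N"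
  proof (rule ccontr)
    assume "\<not> ?thesis"
    then have "h t \<in> T" "h (t - 1) \<in> T" using t tj hT[of t] hT[of "t - 1"] by simp_all
    then show False using mid[of y t x] t(1) c_eq by (simp add: insert_commute)
  qed
  \<comment> \<open>Of the four ways to join an end of one arc to an end of the other, two give back
    the deleted sides.\<close>
  have "c \<noteq> h i" "c \<noteq> h j" using c by auto
  then have "c = {r i, r j} \<or> c = {r (i + 1), r (j + 1)}"
    using s' t' s(1) t(1) c_eq by (elim disjE) (simp_all add: h_def insert_commute)
  then show ?thesis using ij' eq by (auto simp: Dm_def Dp_def)
qed

lemma chord_not_hull:
  assumes "i + 2 \<le> j" "j \<le> i + N - 2"
  shows "{r i, r j} \<notin> H"
  using hull_neighbour[of i "r j"] r_eqD[of j "i + 1"] r_eqD[of j "i - 1 + N"] assms by auto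

section \<open>Boundary paths and their neighbours\<close>

lemma B_iff:
  assumes "S \<in> SP"
  shows "S \<subseteq> H \<longleftrightarrow> S \<in> range B"
proof
  assume sub: "S \<subseteq> H"
  then have "card (H - S) = 1" using assms n_ge by (simp add: card_Diff_subset SP_finite SP_card)
  then obtain e where e: "H - S = {e}" by (auto simp: card_1_singleton_iff)
  then have "e \<in> H" by blast
  then obtain i where "e = h i" using hE by metis
  then have "S = B i" using e sub by (auto simp: B_def)
  then show "S \<in> range B" by simp
qed (auto simp: B_def)

lemma B_eq_iff: "B i = B j \<longleftrightarrow> r i = r j"
proof -
  have "B i = B j \<longleftrightarrow> h i = h j" unfolding B_def using h_in_H by blast
  then show ?thesis by (simp add: h_eq_iff)
qed

lemma range_B_eq: "range B = (\<lambda>e. H - {e}) ` H"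
  by (auto simp: B_def H_def)

lemma card_range_B: "card (range B) = n"
proof -
  have "inj_on (\<lambda>e. H - {e}) H" by (rule inj_onI) blast
  then show ?thesis by (simp add: range_B_eq card_image)
qed

lemma exchange_B: "B i \<noteq> B j \<Longrightarrow> exchange (B i) (B j)"
proof (rule exchangeI)
  assume "B i \<noteq> B j"
  then have *: "h i \<noteq> h j" by (auto simp: B_def)
  show "h j \<in> B i" using * by (auto simp: B_def)
  show "h i \<notin> B i" by (auto simp: B_def)
  show "B j = insert (h i) (B i - {h j})" using * h_in_H by (auto simp: B_def)
qed

text \<open>As \<open>T\<close> contains a chord, it arises from both \<open>B i\<close> and
  \<open>B j\<close> by inserting that chord. So it still lacks \<open>h i\<close> and
  \<open>h j\<close>, and \<open>h j\<close> is the side deleted from \<open>B i\<close>.\<close>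

lemma common_neighbour_cases:
  assumes T: "T \<in> SP" "T \<notin> range B" and adj: "exchange (B i) T" "exchange (B j) T"
    and ij: "i < j" "j < i + N"
  shows "i + 2 \<le> j \<and> j \<le> i + N - 2 \<and> (T = Dm i j \<or> T = Dp i j)"
proof -
  have neq: "h i \<noteq> h j" using ij by (auto simp: h_eq_iff dest!: r_eqD)
  have nsub: "\<not> T \<subseteq> H" using T B_iff by blast
  obtain e f where e: "e \<in> B i" "T = insert f (B i - {e})" using exchangeE[OF adj(1)] by metis
  obtain e' f' where e': "e' \<in> B j" "T = insert f' (B j - {e'})" using exchangeE[OF adj(2)] by metis
  have f: "f \<notin> H" "f' \<notin> H" using nsub e e' by (auto simp: B_def)
  have "h j \<notin> T" using e' f by (auto simp: B_def)
  then have "e = h j" using e neq by (auto simp: B_def)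
  then have "T = insert f (H - {h i, h j})" using e by (auto simp: B_def)
  then show ?thesis using one_chord_path T(1) f ij by blast
qed

lemma exchange_B_D:
  assumes "i + 2 \<le> j" "j \<le> i + N - 2"
  shows "exchange (B i) (Dm i j)" "exchange (B i) (Dp i j)"
    "exchange (B j) (Dm i j)" "exchange (B j) (Dp i j)"
proof -
  have neq: "h i \<noteq> h j" using assms by (auto simp: h_eq_iff dest!: r_eqD)
  have c: "{r i, r j} \<notin> H" "{r (i + 1), r (j + 1)} \<notin> H"
    using chord_not_hull[of i j] chord_not_hull[of "i + 1" "j + 1"] assms by auto
  have *: "exchange (H - {a}) (insert c (H - {a, b}))" if "a \<noteq> b" "b \<in> H" "c \<notin> H" for a b :: "int set" and c
    using that by (intro exchangeI[of b _ c]) auto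
  show "exchange (B i) (Dm i j)" "exchange (B i) (Dp i j)"
    unfolding B_def Dm_def Dp_def using neq c by (intro * h_in_H; simp)+
  show "exchange (B j) (Dm i j)" "exchange (B j) (Dp i j)"
    unfolding B_def Dm_def Dp_def insert_commute[of "h i"] using neq c by (intro * h_in_H; simp)+
qed

lemma D_diff_H:
  assumes "i + 2 \<le> j" "j \<le> i + N - 2"
  shows "Dm i j - H = {{r i, r j}}" "Dp i j - H = {{r (i + 1), r (j + 1)}}"
  using chord_not_hull[of i j] chord_not_hull[of "i + 1" "j + 1"] assms by (auto simp: Dm_def Dp_def)

lemma D_not_B:
  assumes "i + 2 \<le> j" "j \<le> i + N - 2"
  shows "Dm i j \<notin> range B" "Dp i j \<notin> range B"
  using D_diff_H[OF assms] by (auto simp: B_def)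

text \<open>A test in terms of the graph for two sides to be nonadjacent; automorphisms respect it
  once they are known to preserve \<open>range B\<close>.\<close>

lemma nonadjacent_iff:
  assumes "i < j" "j < i + N"
  shows "(\<exists>T\<in>SP. T \<notin> range B \<and> exchange (B i) T \<and> exchange (B j) T) \<longleftrightarrow>
    i + 2 \<le> j \<and> j \<le> i + N - 2"
  using common_neighbour_cases[OF _ _ _ _ assms] Dm_in_SP[OF assms] exchange_B_D D_not_B
  by meson

text \<open>By counting, a path with one chord has \<open>n - 2\<close> sides and so misses exactly
  two, which is the situation of \<open>one_chord_path\<close>.\<close>

lemma one_chordE:
  assumes T: "T \<in> SP" "card (T - H) = 1"
  obtains i j where "i + 2 \<le> j" "j \<le> i + N - 2" "T = Dm i j \<or> T = Dp i j"
proof -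
  obtain c where c: "T - H = {c}" using T(2) by (auto simp: card_1_singleton_iff)
  have "card (T \<inter> H) = n - 2"
    using card_Int_Diff[of T H] T SP_finite[OF T(1)] SP_card[OF T(1)] by simp
  then have "card (H - T) = 2"
    using card_Int_Diff[of H T] n_ge by (simp add: Int_commute)
  then obtain e f where ef: "H - T = {e, f}" "e \<noteq> f" by (auto simp: card_2_iff)
  have "e \<in> H" using ef by blast
  then obtain i where i: "e = h i" using hE by metis
  obtain j where j: "i \<le> j" "j < i + N" "f = h j" using hE[of f i] ef by blast
  have "i \<noteq> j" using i j ef by auto
  then have ij: "i < j" using j by simp
  have eq: "T = insert c (H - {h i, h j})" "c \<notin> H" using c ef i j by blast+
  from one_chord_path[OF T(1) eq ij j(2)] show ?thesis using that by blast
qed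

text \<open>Expresses a bound on the number of chords by adjacency to boundary paths, so that it is
  invariant under automorphisms fixing these.\<close>

lemma card_chords_le_1_iff:
  assumes "T \<in> SP"
  shows "card (T - H) \<le> 1 \<longleftrightarrow> T \<in> range B \<or> (\<exists>i. exchange (B i) T)"
proof
  assume "card (T - H) \<le> 1"
  then consider "card (T - H) = 0" | "card (T - H) = 1" by linarith
  then show "T \<in> range B \<or> (\<exists>i. exchange (B i) T)"
  proof cases
    case 1
    then have "T \<subseteq> H" using SP_finite[OF assms] by auto
    then show ?thesis using B_iff assms by blast
  next
    case 2
    then show ?thesis using one_chordE[OF assms] exchange_B_D by metis
  qed
next
  assume "T \<in> range B \<or> (\<exists>i. exchange (B i) T)"
  then have "\<exists>f. T - H \<subseteq> {f}"
  proof
    assume "\<exists>i. exchange (B i) T"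
    then obtain i e f where "T = insert f (B i - {e})" by (auto simp: exchange_def)
    then have "T - H \<subseteq> {f}" by (auto simp: B_def)
    then show ?thesis ..
  qed (auto simp: B_def)
  then show "card (T - H) \<le> 1" by (metis card_mono card.empty card_insert_disjoint empty_iff finite.emptyI finite_insert One_nat_def)
qed

text \<open>The path runs along sides up to its first chord. Some hull neighbour of the far end
  \<open>q\<close> of this chord lies on the initial stretch, and it can only be the starting
  vertex; so reversing the stretch replaces the chord by a side.\<close>

lemma first_chord:
  assumes S: "S \<in> SP" and xs: "S = pedges xs" "distinct xs" "set xs = Z" and chord: "\<not> S \<subseteq> H"
  obtains k where "0 < k" "Suc k < length xs" "{xs ! k, xs ! Suc k} \<notin> H"
    "\<And>i. i < k \<Longrightarrow> {xs ! i, xs ! Suc i} \<in> H"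
    "{xs ! 0, xs ! Suc k} \<in> H" "{xs ! 0, xs ! Suc k} \<notin> S"
    "insert {xs ! 0, xs ! Suc k} (S - {{xs ! k, xs ! Suc k}}) \<in> SP"
proof -
  define P where "P = (\<lambda>k. Suc k < length xs \<and> {xs ! k, xs ! Suc k} \<notin> H)"
  define k where "k = (LEAST k. P k)"
  obtain e where "e \<in> S" "e \<notin> H" using chord by blast
  then have "\<exists>k. P k" using xs by (auto simp: P_def elim!: pedges_nthE)
  then have "P k" unfolding k_def by (rule LeastI_ex)
  then have k: "Suc k < length xs" "{xs ! k, xs ! Suc k} \<notin> H" by (auto simp: P_def)
  have below: "{xs ! i, xs ! Suc i} \<in> H" if "i < k" for i
    using not_less_Least[of i P] that k(1) by (auto simp: P_def k_def)
  \<comment> \<open>The first edge of the path is a leaf edge, hence a side.\<close>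
  have "0 < k"
  proof (rule ccontr)
    assume "\<not> 0 < k"
    then have k0: "k = 0" by simp
    have "{xs ! 0, xs ! Suc 0} \<in> H"
    proof (rule leaf_hull[OF S])
      show "{xs ! 0, xs ! Suc 0} \<in> S" using k k0 xs pedges_nthI by auto
      fix e assume e: "e \<in> S" "xs ! 0 \<in> e"
      obtain i where i: "Suc i < length xs" "e = {xs ! i, xs ! Suc i}"
        using pedges_nthE[of e xs] e(1) xs(1) by metis
      then have "xs ! 0 = xs ! i \<or> xs ! 0 = xs ! Suc i" using e(2) by auto
      moreover have "0 < length xs" "i < length xs" using i(1) by linarith+
      ultimately have "i = 0" using xs(2) i nth_eq_iff_index_eq[of xs 0 i] nth_eq_iff_index_eq[of xs 0 "Suc i"] by simp
      then show "e = {xs ! 0, xs ! Suc 0}" using i by simp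
    qed
    then show False using k k0 by simp
  qed
  define us where "us = take k xs"
  define vs where "vs = drop (Suc (Suc k)) xs"
  define p where "p = xs ! k"
  define q where "q = xs ! Suc k"
  have xs_eq: "xs = us @ p # q # vs"
    unfolding us_def vs_def p_def q_def using k by (simp add: Cons_nth_drop_Suc Suc_lessD)
  have us: "us \<noteq> []" "length us = k" "us ! 0 = xs ! 0" using k \<open>0 < k\<close> by (auto simp: us_def)
  have pq: "p \<in> Z" "q \<in> Z" "p \<noteq> q" "{p, q} \<notin> H"
    unfolding p_def q_def xs(3)[symmetric] using k xs(2) by (simp_all add: nth_eq_iff_index_eq)
  obtain a b where ab: "q = r a" "p = r b" "a + 2 \<le> b" "b \<le> a + N - 2"
    using chordE[of q p] pq by (auto simp: insert_commute)
  have S_eq: "S = pedges us \<union> {{last us, p}} \<union> {{p, q}} \<union> pedges (q # vs)"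
    using xs(1) us(1) by (auto simp: xs_eq pedges_append)
  have simple: "simple S" using S by (auto simp: simple_def dest: SP_simple)
  have pqS: "{r a, r b} \<in> S" using S_eq ab by (auto simp: insert_commute)
  have sub: "pedges us \<subseteq> S" "pedges vs \<subseteq> S" using S_eq by (cases vs; auto)+
  have sets: "set us \<subseteq> Z - {r a, r b}" "set vs \<subseteq> Z - {r a, r b}"
    using xs ab unfolding xs_eq by auto
  have cover: "v \<in> set us \<or> v \<in> set vs" if "v \<in> Z" "v \<notin> {r a, r b}" for v
    using that xs(3) ab unfolding xs_eq by auto
  have m1: "r (a + 1) \<in> arc a b" "r (a + 1) \<noteq> r a" "r (a + 1) \<noteq> r b"
    using ab n_ge r_eqD[of "a + 1" a] r_eqD[of "a + 1" b] by (auto simp: in_arcI)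
  have m2: "r (a + N - 1) \<notin> arc a b" "r (a + N - 1) \<noteq> r a" "r (a + N - 1) \<noteq> r b"
    using ab n_ge r_eqD[of "a + N - 1" "a + N"] r_eqD[of "a + N - 1" b] by (auto simp: not_in_arcI)
  text \<open>The two hull neighbours of \<open>q\<close> lie on different sides of the chord, while \<open>us\<close> and \<open>vs\<close>
    each lie on one side: so \<open>us\<close> contains a hull neighbour of \<open>q\<close>.\<close>
  have "\<exists>t\<in>set us. {t, q} \<in> H"
  proof (rule ccontr)
    assume no: "\<not> ?thesis"
    have "{r (a + 1), q} \<in> H" using h_in_H[of a] ab by (auto simp: h_def insert_commute)
    moreover have "{r (a + N - 1), q} \<in> H"
      using h_in_H[of "a + N - 1"] ab by (simp add: h_def)
    ultimately have "r (a + 1) \<notin> set us" "r (a + N - 1) \<notin> set us" using no by auto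
    then have "r (a + 1) \<in> set vs" "r (a + N - 1) \<in> set vs" using cover[of "r (a + 1)"] cover[of "r (a + N - 1)"] m1 m2 by simp_all
    then show False using path_same_side[OF pqS simple sub(2) sets(2)] m1 m2 by blast
  qed
  then obtain i where i: "i < k" "{xs ! i, q} \<in> H"
    using us by (auto simp: in_set_conv_nth us_def)
  \<comment> \<open>An inner vertex of the stretch has its two hull neighbours next to it on the
    path, and \<open>q\<close> would be a third one.\<close>
  have "i = 0"
  proof (rule ccontr)
    assume "i \<noteq> 0"
    then obtain l where l: "i = Suc l" by (cases i) auto
    have "{xs ! i, xs ! l} \<in> H" using below[of l] l i by (auto simp: insert_commute)
    moreover have "{xs ! i, xs ! Suc i} \<in> H" using below[of i] i by auto
    moreover have "xs ! i \<in> Z" using xs(3) i k by (metis Suc_lessD less_trans nth_mem)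
    ultimately have "xs ! l = xs ! Suc i \<or> xs ! l = q \<or> xs ! Suc i = q"
      using i hull_degree_le_2 by blast
    then show False using l i k xs(2) by (auto simp: q_def nth_eq_iff_index_eq)
  qed
  then have e: "{xs ! 0, q} \<in> H" using i by simp
  have e_notin: "{xs ! 0, q} \<notin> S"
  proof -
    have "0 < length xs" using k(1) by linarith
    then show ?thesis
      using xs(1,2) k(1) \<open>0 < k\<close> pedges_nth_iff[of xs 0 "Suc k"] by (simp add: q_def)
  qed
  \<comment> \<open>The stretch up to \<open>p\<close> is traversed backwards, so that it ends in
    \<open>xs ! 0\<close> and continues to \<open>q\<close> along the new side.\<close>
  define ys where "ys = p # rev us"
  have last_ys: "last ys = xs ! 0" using us by (simp add: ys_def last_rev hd_conv_nth)
  have "pedges ys = insert {last us, p} (pedges us)"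
    using us by (simp add: ys_def pedges_Cons hd_rev insert_commute)
  moreover have "pedges (ys @ q # vs) = insert {last ys, q} (pedges ys \<union> pedges (q # vs))"
    by (subst pedges_append) (auto simp: ys_def)
  ultimately have T: "pedges (ys @ q # vs) = insert {xs ! 0, q} (pedges us \<union> {{last us, p}} \<union> pedges (q # vs))"
    by (auto simp: last_ys)
  have "{p, q} \<notin> pedges us \<union> {{last us, p}} \<union> pedges (q # vs)"
  proof -
    have "p \<notin> set us" "p \<notin> set (q # vs)" "q \<notin> set us" using xs(2) unfolding xs_eq by auto
    moreover have "last us \<in> set us" using us by simp
    ultimately show ?thesis
      using in_pedges_subset[of "{p, q}" us] in_pedges_subset[of "{p, q}" "q # vs"] pq(3)
      by (auto simp: doubleton_eq_iff)
  qed
  then have T': "insert {xs ! 0, q} (S - {{p, q}}) = pedges (ys @ q # vs)"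
    using T S_eq by auto
  have "insert {xs ! 0, q} (S - {{p, q}}) \<in> SP"
  proof (rule SP_I[OF _ _ _ T'])
    show "distinct (ys @ q # vs)" using xs(2) unfolding xs_eq ys_def by auto
    show "set (ys @ q # vs) = Z" using xs(3) unfolding xs_eq ys_def by auto
    show "simple (pedges (ys @ q # vs))"
      unfolding T'[symmetric] using simple not_cross_hull[OF e] unfolding simple_def by blast
  qed
  then show ?thesis using that[of k] k \<open>0 < k\<close> below e e_notin by (auto simp: p_def q_def)
qed

text \<open>\<open>first_chord\<close> is applied to the list and to its reversal. With at least two
  chords, the first chord seen from the front is not the first one seen from the back.\<close>

lemma two_lower_neighbours:
  assumes S: "S \<in> SP" and two: "card (S - H) \<ge> 2"
  obtains c c' e e' where "c \<in> S - H" "c' \<in> S - H" "c \<noteq> c'" "e \<in> H - S" "e' \<in> H - S" "e \<noteq> e'"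
    "insert e (S - {c}) \<in> SP" "insert e' (S - {c'}) \<in> SP"
proof -
  obtain xs where xs: "S = pedges xs" "distinct xs" "set xs = Z" "length xs = n"
    using SP_E[OF S] by metis
  have "S - H \<noteq> {}" using two by (metis card.empty not_numeral_le_zero)
  then have chord: "\<not> S \<subseteq> H" by blast
  obtain k where k: "0 < k" "Suc k < n" "{xs ! k, xs ! Suc k} \<notin> H"
    "\<And>i. i < k \<Longrightarrow> {xs ! i, xs ! Suc i} \<in> H"
    "{xs ! 0, xs ! Suc k} \<in> H" "{xs ! 0, xs ! Suc k} \<notin> S"
    "insert {xs ! 0, xs ! Suc k} (S - {{xs ! k, xs ! Suc k}}) \<in> SP"
    using first_chord[OF S xs(1-3) chord] xs(4) by metis
  have rev_xs: "S = pedges (rev xs)" "distinct (rev xs)" "set (rev xs) = Z" "length (rev xs) = n"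
    using xs by simp_all
  obtain l where l: "0 < l" "Suc l < n" "{rev xs ! l, rev xs ! Suc l} \<notin> H"
    "\<And>i. i < l \<Longrightarrow> {rev xs ! i, rev xs ! Suc i} \<in> H"
    "{rev xs ! 0, rev xs ! Suc l} \<in> H" "{rev xs ! 0, rev xs ! Suc l} \<notin> S"
    "insert {rev xs ! 0, rev xs ! Suc l} (S - {{rev xs ! l, rev xs ! Suc l}}) \<in> SP"
    using first_chord[OF S rev_xs(1-3) chord] rev_xs(4) by metis
  have nth: "rev xs ! i = xs ! (n - Suc i)" if "i < n" for i
    using that xs(4) by (simp add: rev_nth)
  \<comment> \<open>The position, counted from the front, of the chord found from the back.\<close>
  define m where "m = n - Suc (Suc l)"
  have m: "rev xs ! Suc l = xs ! m" "rev xs ! l = xs ! Suc m" "rev xs ! 0 = xs ! (n - 1)"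
    "Suc m < n"
    using l(1,2) nth[of l] nth[of "Suc l"] nth[of 0] by (simp_all add: m_def Suc_diff_Suc)
  have km: "k \<le> m"
  proof (rule ccontr)
    assume "\<not> k \<le> m"
    then have "{xs ! m, xs ! Suc m} \<in> H" using k(4) by simp
    then show False using l(3) m by (simp add: insert_commute)
  qed
  have "k \<noteq> m"
  proof
    assume eq: "k = m"
    have "S - H \<subseteq> {{xs ! k, xs ! Suc k}}"
    proof
      fix e assume e: "e \<in> S - H"
      then obtain i where i: "Suc i < n" "e = {xs ! i, xs ! Suc i}" using xs by (auto elim: pedges_nthE)
      have "\<not> i < k" using k(4)[of i] e i by auto
      moreover have "\<not> m < i"
      proof
        assume mi: "m < i"
        define j where "j = n - Suc (Suc i)"
        have "j < l" using mi i unfolding j_def m_def by simp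
        moreover have "rev xs ! Suc j = xs ! i" "rev xs ! j = xs ! Suc i"
          using i nth[of j] nth[of "Suc j"] by (simp_all add: j_def Suc_diff_Suc)
        ultimately show False using l(4)[of j] e i by (auto simp: insert_commute)
      qed
      ultimately show "e \<in> {{xs ! k, xs ! Suc k}}" using eq i by (auto simp: not_less)
    qed
    then have "card (S - H) \<le> 1" by (metis card_mono card.empty card_insert_disjoint empty_iff finite.emptyI finite_insert One_nat_def)
    then show False using two by simp
  qed
  then have km: "k < m" using km by simp
  have mem: "{xs ! k, xs ! Suc k} \<in> S" "{xs ! m, xs ! Suc m} \<in> S"
    using xs k(2) m(4) pedges_nthI by auto
  show ?thesis
  proof (rule that)
    show "{xs ! k, xs ! Suc k} \<in> S - H" using mem k by simp
    show "{xs ! m, xs ! Suc m} \<in> S - H" using mem l(3) m by (simp add: insert_commute)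
    show "{xs ! k, xs ! Suc k} \<noteq> {xs ! m, xs ! Suc m}"
      using km m(4) xs(2,4) by (auto simp: doubleton_eq_iff nth_eq_iff_index_eq)
    show "{xs ! 0, xs ! Suc k} \<in> H - S" using k by simp
    show "{xs ! (n - 1), xs ! m} \<in> H - S" using l m by simp
    show "{xs ! 0, xs ! Suc k} \<noteq> {xs ! (n - 1), xs ! m}"
      using km m(4) xs(2,4) k by (auto simp: doubleton_eq_iff nth_eq_iff_index_eq)
    show "insert {xs ! 0, xs ! Suc k} (S - {{xs ! k, xs ! Suc k}}) \<in> SP" by (rule k)
    show "insert {xs ! (n - 1), xs ! m} (S - {{xs ! m, xs ! Suc m}}) \<in> SP"
      using l(7) m by (simp add: insert_commute)
  qed
qed

text \<open>Deleting \<open>e\<close> leaves the pieces \<open>0\<close> to \<open>k\<close> and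
  \<open>k + 1\<close> to \<open>n - 1\<close> of the list. A completing edge joins them, and inner
  vertices of a piece already have degree two, so only the two ends of each piece are available.
  Some of the four edges coincide if a piece is a single vertex.\<close>

lemma card_completions:
  assumes S: "S \<in> SP" and e: "e \<in> S"
  shows "finite {f. f \<notin> S - {e} \<and> insert f (S - {e}) \<in> SP}"
    "card {f. f \<notin> S - {e} \<and> insert f (S - {e}) \<in> SP} \<le> 4"
proof -
  obtain xs where xs: "S = pedges xs" "distinct xs" "set xs = Z" "length xs = n"
    using SP_E[OF S] by metis
  obtain k where k: "Suc k < n" "e = {xs ! k, xs ! Suc k}" using e xs by (auto elim: pedges_nthE)
  let ?F = "{{xs ! 0, xs ! Suc k}, {xs ! 0, xs ! (n - 1)}, {xs ! k, xs ! Suc k}, {xs ! k, xs ! (n - 1)}}"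
  have R: "{xs ! i, xs ! Suc i} \<in> S - {e}" if "Suc i < n" "i \<noteq> k" for i
    using that k xs pedges_nthI[of i xs] by (auto simp: doubleton_eq_iff nth_eq_iff_index_eq)
  have "f \<in> ?F" if f: "insert f (S - {e}) \<in> SP" for f
  proof -
    define A where "A = (!) xs ` {..k}"
    have A: "xs ! i \<in> A \<longleftrightarrow> i \<le> k" if "i < n" for i
      using that k xs by (auto simp: A_def nth_eq_iff_index_eq)
    have Z: "xs ! i \<in> Z" if "i < n" for i using that xs by (metis nth_mem)
    obtain x y where xy: "{x, y} \<in> insert f (S - {e})" "x \<in> A" "y \<notin> A"
      using SP_connected[OF f, of "xs ! k" A "xs ! Suc k"] A[of k] A[of "Suc k"] Z[of k] Z[of "Suc k"] k(1)
      by (metis Suc_lessD Suc_n_not_le_n order_refl)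
    have "{x, y} \<notin> S - {e}"
    proof
      assume "{x, y} \<in> S - {e}"
      then have "{x, y} \<in> pedges xs" and ne: "{x, y} \<noteq> e" using xs(1) by simp_all
      then obtain i where i: "Suc i < n" "{x, y} = {xs ! i, xs ! Suc i}"
        using pedges_nthE[of "{x, y}" xs] xs(4) by metis
      then have "i \<noteq> k" using k(2) ne by metis
      then have "xs ! i \<in> A \<longleftrightarrow> xs ! Suc i \<in> A" using A i by auto
      then show False using i xy by (auto simp: doubleton_eq_iff)
    qed
    then have f_eq: "f = {x, y}" using xy by auto
    have mid: "y = xs ! i \<or> y = xs ! Suc (Suc i)"
      if "Suc (Suc i) < n" "i \<noteq> k" "Suc i \<noteq> k" "{xs ! Suc i, y} = f" for i y
    proof -
      have "{xs ! Suc i, xs ! i} \<in> insert f (S - {e})" "{xs ! Suc i, xs ! Suc (Suc i)} \<in> insert f (S - {e})"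
        using R[of i] R[of "Suc i"] that by (auto simp: insert_commute)
      moreover have "xs ! i \<noteq> xs ! Suc (Suc i)" using that xs by (simp add: nth_eq_iff_index_eq)
      ultimately show ?thesis using SP_degree_le_2[OF f, of "xs ! Suc i" "xs ! i" "xs ! Suc (Suc i)" y] that by auto
    qed
    obtain a where a: "x = xs ! a" "a \<le> k" using xy by (auto simp: A_def)
    have "a = 0 \<or> a = k"
    proof (rule ccontr)
      assume "\<not> (a = 0 \<or> a = k)"
      then obtain i where i: "a = Suc i" "Suc i < k" using a by (cases a) auto
      then have "y = xs ! i \<or> y = xs ! Suc (Suc i)" using mid[of i y] a f_eq k by auto
      then show False using xy i k A[of i] A[of "Suc (Suc i)"] by auto
    qed
    moreover have "y \<in> Z" using SP_edge_subset[OF f xy(1)] by simp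
    then obtain b where b: "y = xs ! b" "b < n" using xs by (metis in_set_conv_nth)
    then have "k < b" using xy A by auto
    have "b = Suc k \<or> b = n - 1"
    proof (rule ccontr)
      assume *: "\<not> (b = Suc k \<or> b = n - 1)"
      then obtain i where i: "b = Suc i" "k < i" "Suc (Suc i) < n" using \<open>k < b\<close> b by (cases b) auto
      then have "x = xs ! i \<or> x = xs ! Suc (Suc i)" using mid[of i x] b f_eq by (auto simp: insert_commute)
      then show False using xy i A[of i] A[of "Suc (Suc i)"] by auto
    qed
    ultimately show ?thesis using a b f_eq by auto
  qed
  then have sub: "{f. f \<notin> S - {e} \<and> insert f (S - {e}) \<in> SP} \<subseteq> ?F" by blast
  then show "finite {f. f \<notin> S - {e} \<and> insert f (S - {e}) \<in> SP}" by (rule finite_subset) simp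
  have "card {f. f \<notin> S - {e} \<and> insert f (S - {e}) \<in> SP} \<le> card ?F" using sub by (intro card_mono) auto
  also have "\<dots> \<le> 4" by (simp add: card_insert_if)
  finally show "card {f. f \<notin> S - {e} \<and> insert f (S - {e}) \<in> SP} \<le> 4" .
qed

end

section \<open>Rigidity of the boundary paths\<close>

text \<open>The two kinds of cliques in a Johnson graph. A set adjacent to both \<open>S0\<close>
  and \<open>S1\<close> either contains \<open>R\<close>, or contains \<open>a\<close> and
  \<open>b\<close> and lies inside \<open>insert a (insert b R)\<close>.\<close>

lemma Johnson_clique:
  assumes clique: "\<And>S T. S \<in> C \<Longrightarrow> T \<in> C \<Longrightarrow> S \<noteq> T \<Longrightarrow> exchange S T"
    and S0: "S0 \<in> C" "S0 = insert a R" "a \<notin> R" and S1: "S1 \<in> C" "S1 = insert b R" "b \<notin> R" "a \<noteq> b"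
  shows "(\<forall>S\<in>C. R \<subseteq> S) \<or> (\<forall>S\<in>C. S \<subseteq> insert a (insert b R))"
proof -
  have cases: "R \<subseteq> S \<or> a \<in> S \<and> b \<in> S \<and> S \<subseteq> insert a (insert b R)" if S: "S \<in> C" for S
  proof (cases "S = S0 \<or> S = S1")
    case True
    then show ?thesis using S0 S1 by auto
  next
    case False
    then have e: "exchange S0 S" "exchange S1 S" using clique S S0 S1 by auto
    obtain x y where xy: "x \<in> S0" "y \<notin> S0" "S = insert y (S0 - {x})" using exchangeE[OF e(1)] by metis
    obtain x' y' where xy': "x' \<in> S1" "y' \<notin> S1" "S = insert y' (S1 - {x'})" using exchangeE[OF e(2)] by metis
    show ?thesis
    proof (cases "x = a \<or> x' = b")
      case True
      then show ?thesis using xy xy' S0 S1 by auto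
    next
      case False
      then have "a \<in> S" "b \<in> S" using xy xy' S0 S1 by auto
      then have "y = b" using xy S0 S1 by auto
      then show ?thesis using xy S0 \<open>a \<in> S\<close> \<open>b \<in> S\<close> by auto
    qed
  qed
  show ?thesis
  proof (rule ccontr)
    assume no: "\<not> ?thesis"
    then obtain S where S: "S \<in> C" "\<not> S \<subseteq> insert a (insert b R)" by blast
    obtain T where T: "T \<in> C" "\<not> R \<subseteq> T" using no by blast
    have RS: "R \<subseteq> S" using cases S by blast
    have abT: "a \<in> T" "b \<in> T" using cases T by blast+
    \<comment> \<open>A member not inside the union of \<open>S0\<close> and \<open>S1\<close>
      contains neither \<open>a\<close> nor \<open>b\<close>, and a single exchange cannot supply
      both.\<close>
    have "a \<notin> S \<and> b \<notin> S"
    proof (rule ccontr)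
      assume ab: "\<not> (a \<notin> S \<and> b \<notin> S)"
      have "S \<noteq> S0" "S \<noteq> S1" using S S0 S1 by auto
      then have e: "exchange S0 S" "exchange S1 S" using clique S S0 S1 by auto
      obtain x y where xy: "S = insert y (S0 - {x})" "x \<in> S0" "x \<notin> S" using exchangeE[OF e(1)] by metis
      obtain x' y' where xy': "S = insert y' (S1 - {x'})" "x' \<in> S1" "x' \<notin> S" using exchangeE[OF e(2)] by metis
      have "x = a" "x' = b" using xy xy' RS S0 S1 by auto
      then show False using xy xy' ab by blast
    qed
    moreover have "exchange S T" using clique S T RS by auto
    then obtain x y where "T = insert y (S - {x})" using exchangeE by metis
    ultimately show False using abT S1(4) by blast
  qed
qed

context ngon
begin

text \<open>An end of \<open>S0\<close> must stay covered when its only edge in \<open>S0\<close> is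
  deleted from \<open>U\<close>, so \<open>b\<close> joins the two ends and \<open>U\<close> is a
  Hamiltonian cycle. All its edges are sides by \<open>leaf_hull\<close>, and there are as many of
  them as in \<open>H\<close>.\<close>

lemma full_clique_cycle:
  assumes all: "\<And>e. e \<in> U \<Longrightarrow> U - {e} \<in> SP" and S0: "S0 \<in> SP" "U = insert b S0" "b \<notin> S0"
  shows "U = H"
proof -
  obtain xs where xs: "S0 = pedges xs" "distinct xs" "set xs = Z" "length xs = n"
    using SP_E[OF S0(1)] by metis
  define E where "E = (\<lambda>i. {xs ! i, xs ! Suc i})"
  have E: "E i \<in> S0" if "Suc i < n" for i
    using that xs pedges_nthI by (auto simp: E_def)
  have U_edge: "U - {e} \<in> SP" if "e \<in> U" for e by (rule all[OF that])
  have inc: "i = k \<or> Suc i = k" if "xs ! k \<in> E i" "Suc i < n" "k < n" for i k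
    using that xs by (auto simp: E_def nth_eq_iff_index_eq)
  have E_eq: "E i = E j \<longleftrightarrow> i = j" if "Suc i < n" "Suc j < n" for i j
    using that xs by (auto simp: E_def doubleton_eq_iff nth_eq_iff_index_eq)
  have end_in_b: "xs ! k \<in> b" if k: "k < n" "Suc i < n" and only: "\<And>j. Suc j < n \<Longrightarrow> xs ! k \<in> E j \<Longrightarrow> j = i" for k i
  proof -
    have "U - {E i} \<in> SP" using E[OF k(2)] S0 by (intro U_edge) simp
    moreover have "xs ! k \<in> Z" using k xs by (metis nth_mem)
    ultimately obtain w where w: "{xs ! k, w} \<in> U - {E i}" using SP_covers by metis
    show ?thesis
    proof (rule ccontr)
      assume "xs ! k \<notin> b"
      then have "{xs ! k, w} \<in> S0" "{xs ! k, w} \<noteq> E i" using w S0 by auto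
      then obtain j where j: "Suc j < n" "{xs ! k, w} = E j"
        using xs pedges_nthE[of "{xs ! k, w}" xs] unfolding E_def by metis
      then show False using only[of j] \<open>{xs ! k, w} \<noteq> E i\<close> by blast
    qed
  qed
  have first_in: "xs ! 0 \<in> b"
    by (rule end_in_b[of 0 0]) (use n_ge inc[of 0] in auto)
  have last_in: "xs ! (n - 1) \<in> b"
  proof (rule end_in_b[of "n - 1" "n - 2"])
    show "j = n - 2" if "Suc j < n" "xs ! (n - 1) \<in> E j" for j
      using that inc[of "n - 1" j] n_ge by auto
  qed (use n_ge in auto)
  have b_pair: "\<exists>x y. b = {x, y}"
  proof -
    have "E 0 \<in> U" "b \<in> U - {E 0}" using E[of 0] n_ge S0 by auto
    then show ?thesis using SP_doubleton U_edge by metis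
  qed
  have neq: "xs ! 0 \<noteq> xs ! (n - 1)" using xs n_ge by (simp add: nth_eq_iff_index_eq)
  have b_eq: "b = {xs ! 0, xs ! (n - 1)}" using b_pair first_in last_in neq by auto
  text \<open>Every edge of the cycle becomes a leaf edge when a neighbouring edge is removed.\<close>
  have leaf: "e \<in> H" if e: "e \<in> U" "e = {v, w}" and e': "e' \<in> U" "e' \<noteq> e"
    and only: "\<And>f. f \<in> U \<Longrightarrow> v \<in> f \<Longrightarrow> f = e \<or> f = e'" for e e' v w
  proof -
    have "{v, w} \<in> H"
      by (rule leaf_hull[OF U_edge[OF e'(1)]]) (use e e' only in auto)
    then show ?thesis using e by simp
  qed
  have S0_E: "\<exists>i. Suc i < n \<and> f = E i" if "f \<in> S0" for f
    using that xs pedges_nthE[of f xs] unfolding E_def by metis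
  have "f \<in> H" if f: "f \<in> U" for f
  proof (cases "f = b")
    case True
    show ?thesis
    proof (rule leaf[of f "xs ! 0" "xs ! (n - 1)" "E 0"])
      show "E 0 \<in> U" "E 0 \<noteq> f" using E[of 0] n_ge S0 True by auto
      fix g assume g: "g \<in> U" "xs ! 0 \<in> g"
      then show "g = f \<or> g = E 0"
        using S0_E[of g] S0 True inc[of 0] n_ge by auto
    qed (use True b_eq f in auto)
  next
    case False
    then have "f \<in> S0" using f S0 by simp
    then obtain i where i: "Suc i < n" "f = E i" using S0_E by blast
    show ?thesis
    proof (cases i)
      case 0
      show ?thesis
      proof (rule leaf[of f "xs ! 0" "xs ! 1" b])
        fix g assume g: "g \<in> U" "xs ! 0 \<in> g"
        then show "g = f \<or> g = b"
          using S0_E[of g] S0 i 0 inc[of 0] n_ge by auto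
      qed (use i 0 f False S0 in \<open>auto simp: E_def\<close>)
    next
      case (Suc k)
      show ?thesis
      proof (rule leaf[of f "xs ! i" "xs ! Suc i" "E k"])
        show "E k \<in> U" using E[of k] i Suc S0 by auto
        show "E k \<noteq> f" using E_eq[of k i] i Suc by auto
        fix g assume g: "g \<in> U" "xs ! i \<in> g"
        have "g \<noteq> b"
        proof
          assume "g = b"
          then have "xs ! i = xs ! 0 \<or> xs ! i = xs ! (n - 1)" using g b_eq by auto
          then show False using i Suc xs by (auto simp: nth_eq_iff_index_eq)
        qed
        then obtain j where "Suc j < n" "g = E j" using g S0 S0_E[of g] by auto
        then show "g = f \<or> g = E k" using inc[of i j] g i Suc by auto
      qed (use i f in \<open>auto simp: E_def\<close>)
    qed
  qed
  then have "U \<subseteq> H" by blast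
  moreover have "card U = card H" using S0 SP_card[OF S0(1)] SP_finite[OF S0(1)] n_ge by simp
  ultimately show ?thesis by (intro card_subset_eq) auto
qed

lemma clique_eq_boundary:
  assumes C: "C \<subseteq> SP" "card C = n"
    and clique: "\<And>S T. S \<in> C \<Longrightarrow> T \<in> C \<Longrightarrow> S \<noteq> T \<Longrightarrow> exchange S T"
  shows "C = range B"
proof -
  have "C \<noteq> {}" using C n_ge by auto
  then obtain S0 where S0: "S0 \<in> C" by blast
  have "C \<noteq> {S0}"
  proof
    assume "C = {S0}"
    then have "card C = 1" by simp
    then show False using C(2) n_ge by simp
  qed
  then obtain S1 where S1: "S1 \<in> C" "S1 \<noteq> S0" using S0 by blast
  then have "exchange S0 S1" using clique S0 by metis
  then obtain a b where ab: "a \<in> S0" "b \<notin> S0" "S1 = insert b (S0 - {a})" using exchangeE by metis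
  define R where "R = S0 - {a}"
  have S0_eq: "S0 = insert a R" "a \<notin> R" using ab by (auto simp: R_def)
  have S1_eq: "S1 = insert b R" "b \<notin> R" "a \<noteq> b" using ab by (auto simp: R_def)
  define U where "U = insert a (insert b R)"
  \<comment> \<open>Members containing \<open>R\<close> are completions of \<open>S0\<close> without
    \<open>a\<close>, of which there are at most four, fewer than \<open>n\<close>.\<close>
  have "\<not> (\<forall>S\<in>C. R \<subseteq> S)"
  proof
    assume RS: "\<forall>S\<in>C. R \<subseteq> S"
    let ?F = "{f. f \<notin> R \<and> insert f R \<in> SP}"
    have card_S: "card S = n - 1" "finite S" if "S \<in> C" for S using that C SP_card SP_finite by blast+
    have cR: "card R = n - 2" "finite R" using card_S[OF S0] S0_eq by auto
    have "C \<subseteq> (\<lambda>f. insert f R) ` ?F"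
    proof
      fix S assume S: "S \<in> C"
      then have "card (S - R) = 1" using RS card_S[OF S] cR n_ge by (simp add: card_Diff_subset)
      then obtain f where "S - R = {f}" by (auto simp: card_1_singleton_iff)
      then have "S = insert f R" "f \<notin> R" using RS S by auto
      then show "S \<in> (\<lambda>f. insert f R) ` ?F" using S C by auto
    qed
    moreover have F: "finite ?F" "card ?F \<le> 4"
      using card_completions[of S0 a] S0 C ab unfolding R_def by auto
    ultimately have "card C \<le> card ?F" by (meson card_image_le card_mono finite_imageI le_trans)
    then show False using F C n_ge by simp
  qed
  then have sub: "S \<subseteq> U" if "S \<in> C" for S
    using Johnson_clique[of C S0 a R S1 b, OF clique S0 S0_eq S1(1) S1_eq] that unfolding U_def by blast
  have U_S0: "U = insert b S0" using S0_eq by (auto simp: U_def)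
  have card_U: "card U = n" "finite U"
    using U_S0 ab S0 C SP_card[of S0] SP_finite[of S0] n_ge by (auto simp: subset_iff)
  have C_sub: "C \<subseteq> (\<lambda>e. U - {e}) ` U"
  proof
    fix S assume S: "S \<in> C"
    then have "card (U - S) = 1" using sub card_U C SP_card[of S] SP_finite[of S] n_ge
      by (auto simp: card_Diff_subset subset_iff)
    then obtain e where "U - S = {e}" by (auto simp: card_1_singleton_iff)
    then have "S = U - {e}" "e \<in> U" using sub[OF S] by auto
    then show "S \<in> (\<lambda>e. U - {e}) ` U" by auto
  qed
  \<comment> \<open>\<open>C\<close> has \<open>n\<close> elements and \<open>U\<close> only
    \<open>n\<close> edges, so every deletion from \<open>U\<close> occurs in
    \<open>C\<close>.\<close>
  moreover have "card ((\<lambda>e. U - {e}) ` U) \<le> card C"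
    using card_image_le[of U "\<lambda>e. U - {e}"] card_U C by simp
  ultimately have C_eq: "C = (\<lambda>e. U - {e}) ` U"
    using card_U by (intro card_seteq) auto
  have "U = H"
  proof (rule full_clique_cycle[OF _ _ U_S0 ab(2)])
    show "U - {e} \<in> SP" if "e \<in> U" for e using that C C_eq by blast
    show "S0 \<in> SP" using S0 C by blast
  qed
  then show ?thesis using C_eq by (simp add: range_B_eq)
qed

text \<open>The extensionality required by \<open>Bij\<close> is left out, so that plain
  compositions of such maps qualify as they are.\<close>

definition aut :: "(int set set \<Rightarrow> int set set) \<Rightarrow> bool" where
  "aut f \<longleftrightarrow> bij_betw f SP SP \<and> (\<forall>S\<in>SP. \<forall>T\<in>SP. exchange (f S) (f T) \<longleftrightarrow> exchange S T)"

lemma aut_in_SP: "aut f \<Longrightarrow> S \<in> SP \<Longrightarrow> f S \<in> SP"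
  by (auto simp: aut_def bij_betw_def)

lemma aut_inj: "aut f \<Longrightarrow> S \<in> SP \<Longrightarrow> T \<in> SP \<Longrightarrow> f S = f T \<longleftrightarrow> S = T"
  by (auto simp: aut_def bij_betw_def inj_on_def)

lemma aut_exchange: "aut f \<Longrightarrow> S \<in> SP \<Longrightarrow> T \<in> SP \<Longrightarrow> exchange (f S) (f T) \<longleftrightarrow> exchange S T"
  by (auto simp: aut_def)

lemma range_B_subset: "range B \<subseteq> SP"
  using B_in_SP by auto

lemma aut_boundary:
  assumes "aut f"
  shows "f ` range B = range B"
proof (rule clique_eq_boundary)
  have inj: "inj_on f SP" using assms by (simp add: aut_def bij_betw_def)
  show "f ` range B \<subseteq> SP" using aut_in_SP[OF assms] B_in_SP by auto
  have "card (f ` range B) = card (range B)"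
    using inj range_B_subset by (intro card_image) (rule inj_on_subset)
  then show "card (f ` range B) = n" by (simp add: card_range_B)
  fix S T assume "S \<in> f ` range B" "T \<in> f ` range B" "S \<noteq> T"
  then obtain i j where "S = f (B i)" "T = f (B j)" by blast
  moreover from this \<open>S \<noteq> T\<close> have "B i \<noteq> B j" by metis
  ultimately show "exchange S T" using aut_exchange[OF assms B_in_SP B_in_SP] exchange_B by simp
qed

lemma aut_boundary_iff:
  assumes "aut f" "T \<in> SP"
  shows "f T \<in> range B \<longleftrightarrow> T \<in> range B"
proof
  assume "f T \<in> range B"
  then have "f T \<in> f ` range B" using aut_boundary[OF assms(1)] by simp
  then obtain i where "f T = f (B i)" by blast
  then show "T \<in> range B" using aut_inj[OF assms(1,2) B_in_SP] by blast
next
  show "T \<in> range B \<Longrightarrow> f T \<in> range B" using aut_boundary[OF assms(1)] by blast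
qed

section \<open>Automorphisms fixing every boundary path\<close>

context
  fixes f
  assumes f: "aut f" and fB: "\<And>i. f (B i) = B i"
begin

lemma fix_level: "T \<in> SP \<Longrightarrow> card (f T - H) \<le> 1 \<longleftrightarrow> card (T - H) \<le> 1"
  using card_chords_le_1_iff[of T] card_chords_le_1_iff[of "f T"] aut_in_SP[OF f, of T]
    aut_boundary_iff[OF f, of T] aut_exchange[OF f B_in_SP, of T] fB by simp

lemma fix_D_cases:
  assumes ij: "i + 2 \<le> j" "j \<le> i + N - 2" and T: "T = Dm i j \<or> T = Dp i j"
  shows "f T = Dm i j \<or> f T = Dp i j"
proof -
  have less: "i < j" "j < i + N" using ij by auto
  have TSP: "T \<in> SP" using T Dm_in_SP[OF less] Dp_in_SP[OF less] by auto
  have "T \<notin> range B" using T D_not_B[OF ij] by auto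
  then have "f T \<notin> range B" using aut_boundary_iff[OF f TSP] by simp
  moreover have "exchange (B i) (f T)" "exchange (B j) (f T)"
    using exchange_B_D[OF ij] T aut_exchange[OF f B_in_SP TSP] fB by metis+
  ultimately show ?thesis using common_neighbour_cases[OF aut_in_SP[OF f TSP] _ _ _ less] by blast
qed

lemma Dm_neq_Dp:
  assumes ij: "i + 2 \<le> j" "j \<le> i + N - 2"
  shows "{r i, r j} \<noteq> {r (i + 1), r (j + 1)}" "Dm i j \<noteq> Dp i j"
proof -
  have "r i \<noteq> r (i + 1)" "r i \<noteq> r (j + 1)"
    using ij by (auto dest!: r_eqD)
  then show "{r i, r j} \<noteq> {r (i + 1), r (j + 1)}" by auto
  then show "Dm i j \<noteq> Dp i j" using D_diff_H[OF ij] by auto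
qed

text \<open>If \<open>Dm i j\<close> went to \<open>Dp i j\<close>, the image of
  \<open>two_chord_path i j\<close> would have at least two chords and be adjacent to
  \<open>Dp i j\<close> and to one of \<open>Dm i (j - 1)\<close> and \<open>Dp i (j - 1)\<close>.
  It would contain the chords of both: they cross in the case of \<open>Dm i (j - 1)\<close>, and in
  the other case \<open>r (i + 1)\<close> gets degree three. The bound \<open>i + 3 \<le> j\<close>
  makes the sides \<open>i\<close> and \<open>j - 1\<close> nonadjacent as well.\<close>

lemma fix_Dm_aux:
  assumes ij: "i + 3 \<le> j" "j \<le> i + N - 2"
  shows "f (Dm i j) = Dm i j"
proof (rule ccontr)
  assume no: "f (Dm i j) \<noteq> Dm i j"
  have ij': "i + 2 \<le> j" "i < j" "j < i + N" using ij by auto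
  have ij'': "i + 2 \<le> j - 1" "j - 1 \<le> i + N - 2" "i < j - 1" "j - 1 < i + N" using ij by auto
  have fDm: "f (Dm i j) = Dp i j" using fix_D_cases[OF ij'(1) ij(2), of "Dm i j"] no by auto
  let ?D = "Dp i (j - 1)"
  define cp where "cp = {r (i + 1), r (j + 1)}"
  have hs: "h i \<noteq> h j" "h i \<noteq> h (j - 1)" "h j \<noteq> h (j - 1)"
    "h (i + 1) \<noteq> h i" "h (i + 1) \<noteq> h j" "h (i + 1) \<noteq> h (j - 1)"
    using ij by (auto simp: h_eq_iff dest!: r_eqD)
  have c: "{r i, r j} \<notin> H" "{r (i + 1), r j} \<notin> H" "cp \<notin> H"
    using chord_not_hull[of i j] chord_not_hull[of "i + 1" j] chord_not_hull[of "i + 1" "j + 1"] ij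
    by (auto simp: cp_def)
  have rs: "r i \<noteq> r (i + 1)" "r i \<noteq> r j" "r j \<noteq> r (i + 1)" "r (i + 2) \<noteq> r j" "r (i + 2) \<noteq> r (j + 1)"
    "r j \<noteq> r (j + 1)" "r i \<noteq> r (j + 1)" "r (j - 1) \<noteq> r (j + 1)"
    using ij by (auto dest!: r_eqD)
  have two_chord_path: "two_chord_path i j \<in> SP" using ij by (intro two_chord_path_in_SP) auto
  have gen: "exchange (insert a (H - {x, y})) (insert a (insert b (H - {x, y, z})))"
    if "z \<in> H" "z \<noteq> x" "z \<noteq> y" "a \<notin> H" "b \<notin> H" "a \<noteq> b" for a b x y z :: "int set"
    by (rule exchangeI[of z _ b]) (use that in auto)
  have neq: "{r i, r j} \<noteq> {r (i + 1), r j}" using rs by (simp add: doubleton_eq_iff)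
  have ex1: "exchange (Dm i j) (two_chord_path i j)"
    unfolding Dm_def two_chord_path_def using gen[of "h (j - 1)" "h i" "h j"] h_in_H hs c neq by metis
  have D_eq: "?D = insert {r (i + 1), r j} (H - {h i, h (j - 1)})" by (simp add: Dp_def)
  have two_chord_path_eq: "two_chord_path i j = insert {r (i + 1), r j} (insert {r i, r j} (H - {h i, h (j - 1), h j}))"
    by (simp add: two_chord_path_def insert_commute)
  have ex2: "exchange ?D (two_chord_path i j)"
    unfolding D_eq two_chord_path_eq using gen[of "h j" "h i" "h (j - 1)"] h_in_H hs c neq by metis
  have "{{r i, r j}, {r (i + 1), r j}} \<subseteq> two_chord_path i j - H" using c by (auto simp: two_chord_path_def)
  moreover have "card {{r i, r j}, {r (i + 1), r j}} = 2" using rs by (simp add: doubleton_eq_iff)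
  ultimately have "2 \<le> card (two_chord_path i j - H)"
    using card_mono[of "two_chord_path i j - H"] SP_finite[OF two_chord_path] by (metis finite_Diff)
  then have two: "\<not> card (f (two_chord_path i j) - H) \<le> 1" using fix_level[OF two_chord_path] by simp
  define T where "T = f (two_chord_path i j)"
  have T: "T \<in> SP" unfolding T_def by (rule aut_in_SP[OF f two_chord_path])
  have "exchange (Dp i j) T"
    using aut_exchange[OF f Dm_in_SP[OF ij'(2,3)] two_chord_path] ex1 fDm by (simp add: T_def)
  then obtain e d where e: "T = insert d (Dp i j - {e})" "e \<in> Dp i j" using exchangeE by metis
  \<comment> \<open>\<open>T\<close> has at least two chords and \<open>Dp i j\<close> only
    \<open>cp\<close>, so the exchange keeps \<open>cp\<close> and adds a chord.\<close>
  have two_d: "d \<notin> H \<and> e \<noteq> cp"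
  proof (rule ccontr)
    assume "\<not> ?thesis"
    then have "T - H \<subseteq> {cp} \<or> T - H \<subseteq> {d}" using e by (auto simp: Dp_def cp_def)
    then have "card (T - H) \<le> 1"
      by (metis card_mono card.empty card_insert_disjoint empty_iff finite.emptyI finite_insert One_nat_def)
    then show False using two by (simp add: T_def)
  qed
  then have cpT: "cp \<in> T" "T - H \<subseteq> {cp, d}" using e by (auto simp: Dp_def cp_def)
  have DSP: "?D \<in> SP" by (rule Dp_in_SP[OF ij''(3,4)])
  have fD: "f ?D = Dm i (j - 1) \<or> f ?D = ?D" using fix_D_cases[OF ij''(1,2)] by blast
  have "exchange (f ?D) T" unfolding T_def aut_exchange[OF f DSP two_chord_path] by (rule ex2)
  then obtain e' d' where e': "T = insert d' (f ?D - {e'})" "e' \<in> f ?D" using exchangeE by metis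
  define c' where "c' = (if f ?D = ?D then {r (i + 1), r j} else {r i, r (j - 1)})"
  have fD_eq: "f ?D = insert c' (H - {h i, h (j - 1)})"
  proof (cases "f ?D = ?D")
    case True
    then show ?thesis unfolding c'_def using D_eq by simp
  next
    case False
    then show ?thesis unfolding c'_def using fD by (simp add: Dm_def)
  qed
  have two_d': "d' \<notin> H \<and> e' \<noteq> c'"
  proof (rule ccontr)
    assume "\<not> ?thesis"
    then have "T - H \<subseteq> {c'} \<or> T - H \<subseteq> {d'}" using e' fD_eq by auto
    then have "card (T - H) \<le> 1"
      by (metis card_mono card.empty card_insert_disjoint empty_iff finite.emptyI finite_insert One_nat_def)
    then show False using two by (simp add: T_def)
  qed
  have c'T: "c' \<in> T" using e' fD_eq two_d' by auto
  have "c' = {r (i + 1), r j} \<or> c' = {r i, r (j - 1)}" by (auto simp: c'_def)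
  then show False
  proof
    assume "c' = {r i, r (j - 1)}"
    \<comment> \<open>The end points interleave in the cyclic order \<open>i\<close>,
      \<open>i + 1\<close>, \<open>j - 1\<close>, \<open>j + 1\<close>.\<close>
    then have "cross c' cp" unfolding cp_def using ij crossI[of i "i + 1" "j - 1" "j + 1"] by simp
    then show False using SP_simple[OF T] c'T cpT by blast
  next
    assume c': "c' = {r (i + 1), r j}"
    then have "c' \<notin> H" using c by simp
    have "h (j - 1) \<notin> f ?D"
      unfolding fD_eq using \<open>c' \<notin> H\<close> h_in_H[of "j - 1"] by (metis Diff_iff insert_iff)
    moreover have "h (j - 1) \<noteq> d'" using two_d' h_in_H by metis
    ultimately have "h (j - 1) \<notin> T" unfolding e'(1) by blast
    moreover have in_D: "h (j - 1) \<in> Dp i j" "h (i + 1) \<in> Dp i j" using hs by (simp_all add: Dp_def)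
    \<comment> \<open>\<open>T\<close> lacks \<open>h (j - 1)\<close> because \<open>f ?D\<close>
      does and only a chord was added; so this is the side that \<open>Dp i j\<close> gives up, and
      \<open>h (i + 1)\<close> survives as a third edge at \<open>r (i + 1)\<close>.\<close>
    ultimately have "e = h (j - 1)" unfolding e(1) by blast
    then have "h (i + 1) \<in> T" unfolding e(1) using in_D(2) hs by blast
    then have "{r (i + 1), r (i + 2)} \<in> T" by (simp add: h_def add.commute)
    moreover have "{r (i + 1), r j} \<in> T" "{r (i + 1), r (j + 1)} \<in> T" using c'T c' cpT by (auto simp: cp_def)
    ultimately have "r (i + 2) = r j \<or> r (i + 2) = r (j + 1) \<or> r j = r (j + 1)"
      by (rule SP_degree_le_2[OF T])
    then show False using rs by auto
  qed
qed

lemma fix_D: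
  assumes ij: "i + 2 \<le> j" "j \<le> i + N - 2"
  shows "f (Dm i j) = Dm i j" "f (Dp i j) = Dp i j"
proof -
  show m: "f (Dm i j) = Dm i j"
  proof (cases "i + 3 \<le> j")
    case True
    then show ?thesis using fix_Dm_aux ij by simp
  next
    case False
    \<comment> \<open>For \<open>j = i + 2\<close> the two sides are taken in the other order: from
      \<open>j\<close> to \<open>i + N\<close> the distance is \<open>N - 2\<close>, which is at
      least three.\<close>
    then have "f (Dm j (i + N)) = Dm j (i + N)" using ij N_ge by (intro fix_Dm_aux) auto
    moreover have "Dm j (i + N) = Dm i j" by (simp add: Dm_def insert_commute)
    ultimately show ?thesis by simp
  qed
  have less: "i < j" "j < i + N" using ij by auto
  have "f (Dp i j) \<noteq> f (Dm i j)"
    using aut_inj[OF f Dp_in_SP[OF less] Dm_in_SP[OF less]] Dm_neq_Dp[OF ij] by simp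
  then show "f (Dp i j) = Dp i j" using fix_D_cases[OF ij, of "Dp i j"] m by auto
qed

lemma fix_all: "S \<in> SP \<Longrightarrow> f S = S"
proof (induction "card (S - H)" arbitrary: S rule: less_induct)
  case less
  then have S: "S \<in> SP" by simp
  consider "card (S - H) = 0" | "card (S - H) = 1" | "card (S - H) \<ge> 2" by linarith
  then show ?case
  proof cases
    case 1
    then have "S \<subseteq> H" using SP_finite[OF S] by auto
    then show ?thesis using B_iff[OF S] fB by auto
  next
    case 2
    then show ?thesis using one_chordE[OF S] fix_D by metis
  next
    case 3
    then obtain c c' e e' where c: "c \<in> S - H" "c' \<in> S - H" "c \<noteq> c'"
      and e: "e \<in> H - S" "e' \<in> H - S" "e \<noteq> e'"
      and T: "insert e (S - {c}) \<in> SP" "insert e' (S - {c'}) \<in> SP"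
      using two_lower_neighbours[OF S] by metis
    have fS: "f S \<in> SP" by (rule aut_in_SP[OF f S])
    have fin: "finite (S - H)" "finite (f S - H)" using SP_finite S fS by auto
    \<comment> \<open>With fewer chords, \<open>f S\<close> would be fixed by the induction
      hypothesis, and injectivity would give \<open>f S = S\<close>.\<close>
    have ge: "card (S - H) \<le> card (f S - H)"
    proof (rule ccontr)
      assume lt: "\<not> ?thesis"
      then have "f (f S) = f S" using less.hyps[of "f S"] fS by simp
      then show False using aut_inj[OF f fS S] lt by simp
    qed
    \<comment> \<open>The neighbour obtained by replacing the chord \<open>a\<close> by the side
      \<open>b\<close> is fixed and adjacent to \<open>f S\<close>. As \<open>f S\<close> has no
      fewer chords than \<open>S\<close>, the exchange leading to it trades a side \<open>x\<close>
      for a chord \<open>y\<close>.\<close>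
    have lower: "\<exists>x y. f S = insert y (insert b (S - {a}) - {x}) \<and> x \<in> H \<and> y \<notin> H \<and> S - H - {a} \<subseteq> f S
        \<and> card (f S - H) = card (S - H)"
      if ab: "a \<in> S - H" "b \<in> H - S" "insert b (S - {a}) \<in> SP" for a b
    proof -
      let ?T = "insert b (S - {a})"
      have TH: "?T - H = S - H - {a}" using ab by auto
      have card_T: "card (?T - H) = card (S - H) - 1" "card (S - H) > 0"
        unfolding TH using ab fin by (auto simp: card_gt_0_iff)
      then have fT: "f ?T = ?T" using less.hyps[of ?T] ab(3) by simp
      have "exchange ?T S" by (rule exchangeI[of b _ a]) (use ab in auto)
      then have "exchange ?T (f S)" using aut_exchange[OF f ab(3) S] fT by simp
      then obtain x y where xy: "x \<in> ?T" "y \<notin> ?T" "f S = insert y (?T - {x})" using exchangeE by metis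
      have finT: "finite (?T - H)" unfolding TH using fin by simp
      have y: "y \<notin> H"
      proof
        assume "y \<in> H"
        then have "f S - H \<subseteq> ?T - H" unfolding xy(3) by blast
        then have "card (f S - H) \<le> card (?T - H)" by (rule card_mono[OF finT])
        then show False using card_T ge by linarith
      qed
      have x: "x \<in> H"
      proof (rule ccontr)
        assume "x \<notin> H"
        then have "f S - H = insert y (?T - H - {x})" "x \<in> ?T - H"
          unfolding xy(3) using xy(1) y by blast+
        then have "card (f S - H) \<le> card (?T - H)"
          using finT card_Suc_Diff1[OF finT] by (simp add: card_insert_if)
        then show False using card_T ge by simp
      qed
      have eq: "f S - H = insert y (?T - H)" unfolding xy(3) using x y by blast
      then have "card (f S - H) = card (S - H)" using card_T xy(2) finT by simp
      moreover have "S - H - {a} \<subseteq> f S" using eq TH by blast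
      ultimately show ?thesis using xy(3) x y by metis
    qed
    obtain x y where xy: "f S = insert y (insert e (S - {c}) - {x})" "x \<in> H" "y \<notin> H" "S - H - {c} \<subseteq> f S"
      "card (f S - H) = card (S - H)" using lower[OF c(1) e(1) T(1)] by metis
    obtain x' y' where xy': "f S = insert y' (insert e' (S - {c'}) - {x'})" "x' \<in> H" "y' \<notin> H" "S - H - {c'} \<subseteq> f S"
      using lower[OF c(2) e(2) T(2)] by metis
    \<comment> \<open>Each neighbour loses only its own chord, so together they show that
      \<open>f S\<close> has all chords of \<open>S\<close>; by cardinality it has no
      others.\<close>
    have "S - H \<subseteq> (S - H - {c}) \<union> (S - H - {c'})" using c(3) by blast
    then have "S - H \<subseteq> f S - H" using xy(4) xy'(4) by blast
    then have chords: "S - H = f S - H" using xy(5) fin by (intro card_subset_eq) auto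
    then have mem: "c \<in> f S" "c' \<in> f S" using c by blast+
    have y: "y = c" using mem(1) c e unfolding xy(1) by blast
    have y': "y' = c'" using mem(2) c e unfolding xy'(1) by blast
    show ?thesis
    proof (cases "x = e")
      case True
      then show ?thesis unfolding xy(1) y using c e by blast
    next
      case False
      \<comment> \<open>The first description of \<open>f S\<close> keeps \<open>e\<close> unless it
        is the removed side; the second one does not admit \<open>e\<close> at all.\<close>
      then have "e \<in> f S" unfolding xy(1) by blast
      then have "e \<in> insert y' (insert e' (S - {c'}) - {x'})" unfolding xy'(1) .
      then show ?thesis using e c y' by blast
    qed
  qed
qed

end

end

section \<open>The action of the dihedral group\<close>

lemma graph_automorphismsD:
  assumes "f \<in> graph_automorphisms G"
  shows "f \<in> extensional (pverts G)" "bij_betw f (pverts G) (pverts G)"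
    "u \<in> pverts G \<Longrightarrow> v \<in> pverts G \<Longrightarrow> (f u, f v) \<in> parcs G \<longleftrightarrow> (u, v) \<in> parcs G"
    "u \<in> pverts G \<Longrightarrow> f u \<in> pverts G"
  using assms by (auto simp: graph_automorphisms_def Bij_def bij_betw_def)

lemma graph_automorphismsI:
  assumes "bij_betw f (pverts G) (pverts G)"
    "\<And>u v. u \<in> pverts G \<Longrightarrow> v \<in> pverts G \<Longrightarrow> (f u, f v) \<in> parcs G \<longleftrightarrow> (u, v) \<in> parcs G"
  shows "restrict f (pverts G) \<in> graph_automorphisms G"
  using assms by (auto simp: graph_automorphisms_def Bij_def)

lemma carrier_Aut [simp]: "carrier (Aut G) = graph_automorphisms G"
  by (simp add: Aut_def)

lemma mult_Aut: "f \<in> graph_automorphisms G \<Longrightarrow> g \<in> graph_automorphisms G \<Longrightarrow>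
    f \<otimes>\<^bsub>Aut G\<^esub> g = compose (pverts G) f g"
  by (simp add: Aut_def BijGroup_def graph_automorphisms_def)

text \<open>Conjugation by \<open>F\<close> is the isomorphism; \<open>\<Psi>\<close> and its
  inverse \<open>\<Xi>\<close> restrict their values so as to produce the extensional functions of
  \<open>Bij\<close>.\<close>

lemma Aut_iso:
  assumes F: "bij_betw F (pverts G) (pverts G')"
    and arcs: "\<And>u v. u \<in> pverts G \<Longrightarrow> v \<in> pverts G \<Longrightarrow> (F u, F v) \<in> parcs G' \<longleftrightarrow> (u, v) \<in> parcs G"
  shows "Aut G \<cong> Aut G'"
proof -
  let ?V = "pverts G" and ?V' = "pverts G'"
  define K where "K = inv_into ?V F"
  have K: "bij_betw K ?V' ?V" unfolding K_def by (rule bij_betw_inv_into[OF F])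
  have KF: "K (F u) = u" if "u \<in> ?V" for u
    unfolding K_def using F that by (simp add: bij_betw_def)
  have FK: "F (K u) = u" if "u \<in> ?V'" for u
    unfolding K_def using F that by (simp add: bij_betw_def f_inv_into_f)
  have FV: "F u \<in> ?V'" if "u \<in> ?V" for u using F that by (auto simp: bij_betw_def)
  have KV: "K u \<in> ?V" if "u \<in> ?V'" for u using K that by (auto simp: bij_betw_def)
  have arcs': "(K u, K v) \<in> parcs G \<longleftrightarrow> (u, v) \<in> parcs G'" if "u \<in> ?V'" "v \<in> ?V'" for u v
    using arcs[of "K u" "K v"] that by (simp add: FK KV)
  define \<Psi> where "\<Psi> = (\<lambda>f. \<lambda>u\<in>?V'. F (f (K u)))"
  define \<Xi> where "\<Xi> = (\<lambda>f. \<lambda>u\<in>?V. K (f (F u)))"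
  have \<Psi>_in: "\<Psi> f \<in> graph_automorphisms G'" if f: "f \<in> graph_automorphisms G" for f
    unfolding \<Psi>_def
  proof (rule graph_automorphismsI)
    have "bij_betw (F \<circ> (f \<circ> K)) ?V' ?V'"
      using graph_automorphismsD(2)[OF f] K F by (metis bij_betw_trans)
    then show "bij_betw (\<lambda>u. F (f (K u))) ?V' ?V'" by (simp add: comp_def)
    show "(F (f (K u)), F (f (K v))) \<in> parcs G' \<longleftrightarrow> (u, v) \<in> parcs G'" if "u \<in> ?V'" "v \<in> ?V'" for u v
      using that arcs' arcs KV graph_automorphismsD(3,4)[OF f] by simp
  qed
  have \<Xi>_in: "\<Xi> f \<in> graph_automorphisms G" if f: "f \<in> graph_automorphisms G'" for f
    unfolding \<Xi>_def
  proof (rule graph_automorphismsI)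
    have "bij_betw (K \<circ> (f \<circ> F)) ?V ?V"
      using graph_automorphismsD(2)[OF f] K F by (metis bij_betw_trans)
    then show "bij_betw (\<lambda>u. K (f (F u))) ?V ?V" by (simp add: comp_def)
    show "(K (f (F u)), K (f (F v))) \<in> parcs G \<longleftrightarrow> (u, v) \<in> parcs G" if "u \<in> ?V" "v \<in> ?V" for u v
      using that arcs' arcs FV graph_automorphismsD(3,4)[OF f] by simp
  qed
  have "\<Psi> \<in> hom (Aut G) (Aut G')"
  proof (rule homI)
    fix f g assume "f \<in> carrier (Aut G)" "g \<in> carrier (Aut G)"
    then have fg: "f \<in> graph_automorphisms G" "g \<in> graph_automorphisms G" by simp_all
    have "\<Psi> (compose ?V f g) = compose ?V' (\<Psi> f) (\<Psi> g)"
      by (rule extensionalityI[of _ ?V'])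
        (use graph_automorphismsD(4)[OF fg(2)] FV KV KF in \<open>auto simp: \<Psi>_def compose_def\<close>)
    then show "\<Psi> (f \<otimes>\<^bsub>Aut G\<^esub> g) = \<Psi> f \<otimes>\<^bsub>Aut G'\<^esub> \<Psi> g"
      using fg by (simp add: mult_Aut \<Psi>_in)
  qed (use \<Psi>_in in simp)
  moreover have "bij_betw \<Psi> (carrier (Aut G)) (carrier (Aut G'))"
  proof (rule bij_betw_byWitness[of _ \<Xi>])
    show "\<forall>f\<in>carrier (Aut G). \<Xi> (\<Psi> f) = f"
    proof
      fix f assume "f \<in> carrier (Aut G)"
      then have f: "f \<in> graph_automorphisms G" by simp
      show "\<Xi> (\<Psi> f) = f"
        by (rule extensionalityI[of _ ?V])
          (use graph_automorphismsD(1,4)[OF f] FV KF in \<open>auto simp: \<Psi>_def \<Xi>_def\<close>)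
    qed
    show "\<forall>f\<in>carrier (Aut G'). \<Psi> (\<Xi> f) = f"
    proof
      fix f assume "f \<in> carrier (Aut G')"
      then have f: "f \<in> graph_automorphisms G'" by simp
      show "\<Psi> (\<Xi> f) = f"
        by (rule extensionalityI[of _ ?V'])
          (use graph_automorphismsD(1,4)[OF f] KV FK in \<open>auto simp: \<Psi>_def \<Xi>_def\<close>)
    qed
  qed (use \<Psi>_in \<Xi>_in in auto)
  ultimately show ?thesis by (auto simp: is_iso_def iso_def)
qed

lemma exchange_image:
  assumes "inj_on F (S \<union> T)" "exchange S T"
  shows "exchange (F ` S) (F ` T)"
proof -
  obtain e f where ef: "e \<in> S" "f \<notin> S" "T = insert f (S - {e})" using assms(2) by (auto simp: exchange_def)
  have "F f \<notin> F ` S"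
  proof
    assume "F f \<in> F ` S"
    then obtain g where "g \<in> S" "F f = F g" by blast
    then have "f = g" using assms(1) ef by (auto dest: inj_onD)
    then show False using \<open>g \<in> S\<close> ef by simp
  qed
  moreover have "F ` (S - {e}) = F ` S - {F e}"
    using inj_on_image_set_diff[OF assms(1), of S "{e}"] ef by auto
  ultimately show ?thesis using ef by (intro exchangeI[of "F e" _ "F f"]) auto
qed

section \<open>Rotations and reflections acting on paths\<close>

context ngon
begin

definition sym :: "int \<times> bool \<Rightarrow> int \<Rightarrow> int" where
  "sym g x = r (if snd g then fst g - x else fst g + x)"

text \<open>The first component is not reduced modulo \<open>n\<close>, since \<open>sym\<close>
  reduces its result anyway. A reflection is its own inverse.\<close>

definition sym_inv :: "int \<times> bool \<Rightarrow> int \<times> bool" where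
  "sym_inv g = (if snd g then fst g else - fst g, snd g)"

definition act :: "int \<times> bool \<Rightarrow> int set set \<Rightarrow> int set set" where
  "act g S = (`) (sym g) ` S"

lemma r_mod_simps [simp]: "r (a + r b) = r (a + b)" "r (a - r b) = r (a - b)"
    "r (r a + b) = r (a + b)" "r (r a - b) = r (a - b)" "r (r a) = r a"
  by (simp_all add: r_def mod_simps)

lemma sym_r: "sym g (r x) = r (if snd g then fst g - x else fst g + x)"
  by (simp add: sym_def)

lemma sym_in_Z [simp]: "sym g x \<in> Z"
  by (simp add: sym_def)

lemma sym_inv_inv [simp]: "sym_inv (sym_inv g) = g"
  by (cases g) (simp add: sym_inv_def)

lemma sym_inv_sym: "x \<in> Z \<Longrightarrow> sym (sym_inv g) (sym g x) = x"
  by (simp add: sym_def sym_inv_def r_id)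

lemma inj_on_sym: "inj_on (sym g) Z"
  by (rule inj_on_inverseI[of _ "sym (sym_inv g)"]) (rule sym_inv_sym)

lemma sym_image_Z: "sym g ` Z = Z"
  by (rule endo_inj_surj) (auto simp: inj_on_sym)

lemma sym_image_inv: "e \<subseteq> Z \<Longrightarrow> sym (sym_inv g) ` (sym g ` e) = e"
proof -
  assume "e \<subseteq> Z"
  then have "(\<lambda>x. sym (sym_inv g) (sym g x)) ` e = (\<lambda>x. x) ` e"
    by (intro image_cong) (auto simp: sym_inv_sym)
  then show ?thesis by (simp add: image_image)
qed

lemma cross_image_sym:
  assumes "cross e f"
  shows "cross (sym g ` e) (sym g ` f)"
proof -
  obtain x y z w where *: "x < y" "y < z" "z < w" "w < x + N" "e = {r x, r z}" "f = {r y, r w}"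
    using assms by (auto simp: cross_def)
  obtain a s where g: "g = (a, s)" by (cases g)
  show ?thesis
  proof (cases s)
    case False
    then show ?thesis using * crossI[of "a + x" "a + y" "a + z" "a + w"] by (simp add: g sym_r)
  next
    case True
    \<comment> \<open>A reflection reverses the cyclic order, so the image of \<open>w\<close> comes
      first and the two edges change roles.\<close>
    then have "cross (sym g ` f) (sym g ` e)"
      using * crossI[of "a - w" "a - z" "a - y" "a - x"] by (simp add: g sym_r insert_commute)
    then show ?thesis by (rule cross_sym)
  qed
qed

lemma inj_on_image_sym: "inj_on ((`) (sym g)) (Pow Z)"
  by (rule inj_on_inverseI[of _ "(`) (sym (sym_inv g))"]) (simp add: sym_image_inv)

lemma SP_subset_Pow: "S \<in> SP \<Longrightarrow> S \<subseteq> Pow Z"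
  using SP_edge_subset by blast

lemma act_in_SP:
  assumes "S \<in> SP"
  shows "act g S \<in> SP"
proof -
  obtain xs where xs: "S = pedges xs" "distinct xs" "set xs = Z" "simple S"
    using SP_E[OF assms] by metis
  show ?thesis
  proof (rule SP_I)
    show "distinct (map (sym g) xs)" using xs inj_on_sym by (simp add: distinct_map)
    show "set (map (sym g) xs) = Z" using xs sym_image_Z by simp
    show eq: "act g S = pedges (map (sym g) xs)" using xs by (simp add: act_def pedges_map)
    show "simple (pedges (map (sym g) xs))" unfolding eq[symmetric] simple_def
    proof (intro ballI notI)
      fix e' f' assume "e' \<in> act g S" "f' \<in> act g S" and c: "cross e' f'"
      then obtain e f where ef: "e \<in> S" "f \<in> S" "e' = sym g ` e" "f' = sym g ` f" by (auto simp: act_def)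
      then have "cross e f"
        using cross_image_sym[OF c, of "sym_inv g"] SP_edge_subset[OF assms] by (simp add: sym_image_inv)
      then show False using xs(4) ef by (auto simp: simple_def)
    qed
  qed
qed

lemma act_inv:
  assumes "S \<in> SP"
  shows "act (sym_inv g) (act g S) = S"
proof -
  have "act (sym_inv g) (act g S) = (\<lambda>e. e) ` S"
    unfolding act_def image_image[of "(`) (sym (sym_inv g))"]
    using SP_edge_subset[OF assms] by (intro image_cong) (auto simp: sym_image_inv)
  then show ?thesis by simp
qed

lemma act_exchange:
  assumes "S \<in> SP" "T \<in> SP" "exchange S T"
  shows "exchange (act g S) (act g T)"
  unfolding act_def
  by (rule exchange_image[OF inj_on_subset[OF inj_on_image_sym]]) (use assms SP_subset_Pow in auto)

lemma aut_act: "aut (act g)"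
  unfolding aut_def
proof (intro conjI ballI iffI)
  show "bij_betw (act g) SP SP"
    by (rule bij_betw_byWitness[of _ "act (sym_inv g)"])
      (use act_inv[of _ g] act_inv[of _ "sym_inv g"] act_in_SP[of _ g] act_in_SP[of _ "sym_inv g"] in auto)
  fix S T assume ST: "S \<in> SP" "T \<in> SP"
  show "exchange S T \<Longrightarrow> exchange (act g S) (act g T)" using ST act_exchange by blast
  assume "exchange (act g S) (act g T)"
  then have "exchange (act (sym_inv g) (act g S)) (act (sym_inv g) (act g T))"
    by (rule act_exchange[OF act_in_SP[OF ST(1)] act_in_SP[OF ST(2)]])
  then show "exchange S T" using ST by (simp add: act_inv)
qed

text \<open>A side is indexed by its first end point. Under a reflection the image of the second end
  point comes first, whence the \<open>- 1\<close>.\<close>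

lemma sym_image_h: "sym (a, s) ` h i = h (if s then a - i - 1 else a + i)"
  by (simp add: h_def sym_r algebra_simps insert_commute)

lemma act_B: "act (a, s) (B i) = B (if s then a - i - 1 else a + i)"
proof -
  have sub: "H \<subseteq> Pow Z" by (auto simp: H_def h_def)
  have inj: "inj_on ((`) (sym (a, s))) H" using inj_on_subset[OF inj_on_image_sym sub] .
  have "(`) (sym (a, s)) ` H = H"
  proof (rule endo_inj_surj[OF finite_H _ inj])
    show "(`) (sym (a, s)) ` H \<subseteq> H" by (auto simp: H_def sym_image_h)
  qed
  then show ?thesis
    using inj_on_image_set_diff[OF inj, of H "{h i}"] by (simp add: act_def B_def sym_image_h)
qed

lemma r_add_cong: "r x = r y \<Longrightarrow> r (x + z) = r (y + z)"
  by (metis r_mod_simps(3))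

text \<open>On indices, \<open>f\<close> is an injective map of a cycle that sends neighbours to
  neighbours. Such a map cannot change direction, so it is a rotation or a reflection.\<close>

lemma aut_B_dihedral:
  assumes f: "aut f"
  obtains a s where "a \<in> {0..<N}" "\<And>i. f (B i) = act (a, s) (B i)"
proof -
  have "\<forall>i. \<exists>j. f (B i) = B j" using aut_boundary[OF f] by blast
  then obtain p where p: "\<And>i. f (B i) = B (p i)" by metis
  have inj: "r (p i) = r (p j) \<longleftrightarrow> r i = r j" for i j
    using aut_inj[OF f B_in_SP B_in_SP, of i j] by (simp add: p B_eq_iff)
  have step: "r (p (i + 1)) = r (p i + 1) \<or> r (p (i + 1)) = r (p i - 1)" for i
  proof -
    have "r (p (i + 1)) \<noteq> r (p i)" using inj[of "i + 1" i] r_neq_suc[of i] by simp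
    then obtain q where q: "p i < q" "q < p i + N" "r (p (i + 1)) = r q"
      using r_rep_gtE[of "r (p (i + 1))" "p i"] by auto
    have "\<not> (\<exists>T\<in>SP. T \<notin> range B \<and> exchange (B (p i)) T \<and> exchange (B q) T)"
    proof
      assume "\<exists>T\<in>SP. T \<notin> range B \<and> exchange (B (p i)) T \<and> exchange (B q) T"
      then obtain T where T: "T \<in> SP" "T \<notin> range B" "exchange (B (p i)) T" "exchange (B q) T" by blast
      have "T \<in> f ` SP" using T(1) f by (simp add: aut_def bij_betw_def)
      then obtain S where S: "S \<in> SP" "T = f S" by blast
      have "B q = f (B (i + 1))" using q p by (simp add: B_eq_iff)
      then have "exchange (f (B i)) (f S)" "exchange (f (B (i + 1))) (f S)" using T S p[of i] by simp_all
      then have "exchange (B i) S" "exchange (B (i + 1)) S" using aut_exchange[OF f B_in_SP S(1)] by simp_all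
      moreover have "S \<notin> range B" using T(2) S aut_boundary_iff[OF f S(1)] by simp
      ultimately show False using nonadjacent_iff[of i "i + 1"] S n_ge by auto
    qed
    then have "q = p i + 1 \<or> q = p i - 1 + N" using nonadjacent_iff[OF q(1,2)] q by auto
    then show ?thesis using q by auto
  qed
  have "\<exists>\<epsilon>. (\<epsilon> = 1 \<or> \<epsilon> = - 1) \<and> r (p 1) = r (p 0 + \<epsilon>)" using step[of 0] by force
  then obtain \<epsilon> where \<epsilon>: "\<epsilon> = 1 \<or> \<epsilon> = - 1" "r (p 1) = r (p 0 + \<epsilon>)" by blast
  \<comment> \<open>Two consecutive values are carried along: a next step in the direction
    \<open>- \<epsilon>\<close> would return to the value at \<open>k\<close>, against injectivity
    modulo \<open>n\<close>.\<close>
  have all: "r (p (int k)) = r (p 0 + \<epsilon> * int k) \<and> r (p (int k + 1)) = r (p 0 + \<epsilon> * (int k + 1))" for k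
  proof (induction k)
    case 0
    then show ?case using \<epsilon> by simp
  next
    case (Suc k)
    let ?k = "int k"
    have "r (p (?k + 1 + 1)) = r (p (?k + 1) + \<epsilon>) \<or> r (p (?k + 1 + 1)) = r (p (?k + 1) - \<epsilon>)"
      using step[of "?k + 1"] \<epsilon>(1) by auto
    moreover have "r (p (?k + 1) + \<epsilon>) = r (p 0 + \<epsilon> * (?k + 2))"
      using r_add_cong[of "p (?k + 1)" "p 0 + \<epsilon> * (?k + 1)" \<epsilon>] Suc by (simp add: algebra_simps)
    moreover have "r (p (?k + 1) - \<epsilon>) = r (p ?k)"
      using r_add_cong[of "p (?k + 1)" "p 0 + \<epsilon> * (?k + 1)" "- \<epsilon>"] Suc by (simp add: algebra_simps)
    moreover have "r (p (?k + 1 + 1)) \<noteq> r (p ?k)" using inj r_neq_suc2[of ?k] by (simp add: add.assoc)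
    ultimately have "r (p (?k + 2)) = r (p 0 + \<epsilon> * (?k + 2))" by (simp add: add.assoc)
    then show ?case using Suc by (simp add: algebra_simps)
  qed
  have fB: "f (B i) = B (p 0 + \<epsilon> * i)" for i
  proof -
    obtain x where x: "0 \<le> x" "x < 0 + N" "r i = r x" using r_repE[of "r i" 0] by auto
    have Bi: "B i = B x" using x by (simp add: B_eq_iff)
    have "r (p 0 + \<epsilon> * x) = r (p 0 + \<epsilon> * i)"
    proof -
      obtain m where "i = x + m * N" using x(3) by (rule r_eqE)
      then have "p 0 + \<epsilon> * i = p 0 + \<epsilon> * x + (\<epsilon> * m) * N" by (simp add: algebra_simps)
      then show ?thesis using r_add_mult(1) by metis
    qed
    then have "B (p x) = B (p 0 + \<epsilon> * i)" using all[of "nat x"] x by (simp add: B_eq_iff)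
    then show ?thesis using p[of x] unfolding Bi by simp
  qed
  from \<epsilon>(1) show ?thesis
  proof
    assume "\<epsilon> = 1"
    then have "f (B i) = act (r (p 0), False) (B i)" for i by (simp add: act_B fB B_eq_iff)
    then show ?thesis using that[of "r (p 0)"] r_in_Z[of "p 0"] by (simp add: Z_def)
  next
    assume "\<epsilon> = - 1"
    \<comment> \<open>The \<open>+ 1\<close> cancels the shift with which a reflection renumbers the
      sides.\<close>
    moreover have "r (r (p 0 + 1) - i - 1) = r (p 0 - i)" for i
      using r_mod_simps(4)[of "p 0 + 1" "i + 1"] by (simp add: algebra_simps)
    ultimately have "f (B i) = act (r (p 0 + 1), True) (B i)" for i by (simp add: act_B fB B_eq_iff)
    then show ?thesis using that[of "r (p 0 + 1)"] r_in_Z[of "p 0 + 1"] by (simp add: Z_def)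
  qed
qed

lemma act_eq_on_B:
  assumes "a \<in> {0..<N}" "b \<in> {0..<N}" and eq: "\<And>i. act (a, s) (B i) = act (b, t) (B i)"
  shows "(a, s) = (b, t)"
proof -
  have eq': "r (if s then a - i - 1 else a + i) = r (if t then b - i - 1 else b + i)" for i
    using eq[of i] by (simp add: act_B B_eq_iff)
  \<comment> \<open>A rotation and a reflection of the indices already disagree at 0 or at 1, as
    \<open>n\<close> does not divide 2.\<close>
  have no: False if "\<And>i. r (x - i - 1) = r (y + i)" for x y
  proof -
    have "r (x - 1) = r (y + 2 * 0)" "r (x - 2) = r (y + 1)" using that[of 0] that[of 1] by simp_all
    then have "r (y - 1) = r (y + 1)" using r_add_cong[of "x - 1" y "- 1"] by simp
    then show False using r_neq_suc2[of "y - 1"] by (simp add: add.commute)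
  qed
  have st: "s = t"
  proof (rule ccontr)
    assume "s \<noteq> t"
    then consider "s" "\<not> t" | "\<not> s" "t" by blast
    then show False
    proof cases
      case 1
      then have "r (a - i - 1) = r (b + i)" for i using eq'[of i] by simp
      then show False by (rule no)
    next
      case 2
      then have "r (b - i - 1) = r (a + i)" for i using eq'[of i] by simp
      then show False by (rule no)
    qed
  qed
  have "r a = r b"
  proof (cases s)
    case True
    then have "r (a - 1) = r (b - 1)" using eq'[of 0] st by simp
    then show ?thesis using r_add_cong[of "a - 1" "b - 1" 1] by simp
  next
    case False
    then show ?thesis using eq'[of 0] st by simp
  qed
  then show ?thesis using assms(1,2) st by (simp add: r_def)
qed

definition comb_graph :: "int set set pair_pre_digraph" where
  "comb_graph = \<lparr>pverts = SP, parcs = {(S, T). S \<in> SP \<and> T \<in> SP \<and> exchange S T}\<rparr>"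

lemma act_mult:
  assumes "S \<in> SP"
  shows "act ((if s then a - b else a + b) mod N, s \<noteq> t) S = act (a, s) (act (b, t) S)"
proof -
  have "sym ((if s then a - b else a + b) mod N, s \<noteq> t) x = sym (a, s) (sym (b, t) x)" for x
    by (cases s; cases t) (simp_all add: sym_def r_def mod_simps algebra_simps)
  then show ?thesis by (simp add: act_def image_image)
qed

lemma restrict_act_in: "restrict (act g) SP \<in> graph_automorphisms comb_graph"
  using graph_automorphismsI[of "act g" comb_graph] aut_act[of g] act_in_SP
  by (auto simp: comb_graph_def aut_def)

text \<open>Injectivity is tested on the boundary paths alone. For surjectivity, an automorphism
  agrees with some symmetry there; following it by the inverse symmetry gives a map fixing all
  boundary paths, hence the identity.\<close>

lemma dihedral_iso_Aut_comb_graph: "dihedral_group n \<cong> Aut comb_graph"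
proof -
  define \<Phi> where "\<Phi> = (\<lambda>g. restrict (act g) SP)"
  have \<Phi>_in: "\<Phi> g \<in> graph_automorphisms comb_graph" for g
    unfolding \<Phi>_def by (rule restrict_act_in)
  have "\<Phi> \<in> hom (dihedral_group n) (Aut comb_graph)"
  proof (rule homI)
    fix g k assume "g \<in> carrier (dihedral_group n)" "k \<in> carrier (dihedral_group n)"
    obtain a s b t where gk: "g = (a, s)" "k = (b, t)" by (cases g, cases k)
    have "g \<otimes>\<^bsub>dihedral_group n\<^esub> k = ((if s then a - b else a + b) mod N, s \<noteq> t)"
      by (simp add: dihedral_group_def gk)
    then have "act (g \<otimes>\<^bsub>dihedral_group n\<^esub> k) S = act g (act k S)" if "S \<in> SP" for S
      using act_mult[OF that] gk by simp
    then have "\<Phi> (g \<otimes>\<^bsub>dihedral_group n\<^esub> k) = compose SP (\<Phi> g) (\<Phi> k)"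
      unfolding \<Phi>_def using act_in_SP[of _ k]
      by (intro extensionalityI[of _ SP]) (auto simp: compose_def)
    then show "\<Phi> (g \<otimes>\<^bsub>dihedral_group n\<^esub> k) = \<Phi> g \<otimes>\<^bsub>Aut comb_graph\<^esub> \<Phi> k"
      using \<Phi>_in by (simp add: mult_Aut) (simp add: comb_graph_def)
  qed (simp add: \<Phi>_in)
  moreover have "inj_on \<Phi> (carrier (dihedral_group n))"
  proof (rule inj_onI)
    fix g k assume gk: "g \<in> carrier (dihedral_group n)" "k \<in> carrier (dihedral_group n)" "\<Phi> g = \<Phi> k"
    have "act g (B i) = act k (B i)" for i
      using fun_cong[OF gk(3), of "B i"] B_in_SP by (simp add: \<Phi>_def)
    then show "g = k"
      using gk(1,2) act_eq_on_B[of "fst g" "fst k" "snd g" "snd k"] by (auto simp: dihedral_group_def)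
  qed
  moreover have "\<Phi> ` carrier (dihedral_group n) = graph_automorphisms comb_graph"
  proof (intro subset_antisym subsetI)
    fix f assume f: "f \<in> graph_automorphisms comb_graph"
    have aut: "aut f"
      using graph_automorphismsD(2,3)[OF f] by (auto simp: aut_def comb_graph_def bij_betw_def)
    obtain a s where a: "a \<in> {0..<N}" "\<And>i. f (B i) = act (a, s) (B i)"
      using aut_B_dihedral[OF aut] by blast
    let ?k = "act (sym_inv (a, s))"
    have "aut (?k \<circ> f)"
      using aut aut_act[of "sym_inv (a, s)"] aut_in_SP[OF aut] by (auto simp: aut_def intro: bij_betw_trans)
    moreover have "(?k \<circ> f) (B i) = B i" for i using a B_in_SP by (simp add: act_inv)
    ultimately have "?k (f S) = S" if "S \<in> SP" for S using fix_all that by (metis comp_apply)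
    then have "f S = act (a, s) S" if "S \<in> SP" for S
      using that act_inv[of "f S" "sym_inv (a, s)"] aut_in_SP[OF aut] by simp
    then have "f = \<Phi> (a, s)" unfolding \<Phi>_def
      using graph_automorphismsD(1)[OF f] by (intro extensionalityI[of _ SP]) (auto simp: comb_graph_def)
    then show "f \<in> \<Phi> ` carrier (dihedral_group n)" using a(1) by (auto simp: dihedral_group_def)
  qed (use \<Phi>_in in auto)
  ultimately show ?thesis by (auto simp: is_iso_def iso_def bij_betw_def)
qed

end

section \<open>Points in convex position\<close>

text \<open>Twice the signed area of the triangle, positive if it is traversed
  counterclockwise.\<close>

definition ori :: "plane \<Rightarrow> plane \<Rightarrow> plane \<Rightarrow> real" where
  "ori a b c = (b$1 - a$1) * (c$2 - a$2) - (b$2 - a$2) * (c$1 - a$1)"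

lemma ori_cyclic: "ori a b c = ori b c a"
  and ori_swap: "ori a b c = - ori a c b"
  and ori_same [simp]: "ori a a c = 0" "ori a b a = 0" "ori a b b = 0"
  by (simp_all add: ori_def algebra_simps)

lemma ori_affine: "ori a b ((1 - t) *\<^sub>R c + t *\<^sub>R d) = (1 - t) * ori a b c + t * ori a b d"
  by (simp add: ori_def algebra_simps)

lemma plane_eqI: "(x::plane)$1 = y$1 \<Longrightarrow> x$2 = y$2 \<Longrightarrow> x = y"
  by (simp add: vec_eq_iff forall_2)

lemma convex_position_not_in_hull:
  assumes "convex_position P" "p \<in> P"
  shows "p \<notin> convex hull (P - {p})"
proof -
  have "convex (convex hull P - {p})"
    using assms by (simp add: convex_position_def extreme_point_of_stillconvex)
  moreover have "P - {p} \<subseteq> convex hull P - {p}" using hull_subset[of P convex] by blast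
  ultimately have "convex hull (P - {p}) \<subseteq> convex hull P - {p}" by (simp add: hull_minimal)
  then show ?thesis by blast
qed

lemma convex_position_not_in_segment:
  assumes "convex_position P" "p \<in> P" "a \<in> P - {p}" "b \<in> P - {p}"
  shows "p \<notin> closed_segment a b"
proof -
  have "closed_segment a b \<subseteq> convex hull (P - {p})"
    unfolding segment_convex_hull using assms by (intro hull_mono) auto
  then show ?thesis using convex_position_not_in_hull[OF assms(1,2)] by blast
qed

text \<open>The barycentric coordinates of \<open>b\<close> with respect to \<open>p\<close>,
  \<open>a\<close>, \<open>c\<close> are quotients of signed areas by \<open>ori p a c\<close>; the
  hypotheses say that they are nonnegative.\<close>

lemma in_triangle:
  assumes "ori p a b \<ge> 0" "ori p b c \<ge> 0" "ori a b c \<le> 0" "ori p a c > 0"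
  shows "b \<in> convex hull {p, a, c}"
proof -
  let ?D = "ori p a c"
  have D: "?D = - ori a b c + ori p b c + ori p a b"
    by (simp add: ori_def algebra_simps)
  have "?D * b$1 = - ori a b c * p$1 + ori p b c * a$1 + ori p a b * c$1"
    "?D * b$2 = - ori a b c * p$2 + ori p b c * a$2 + ori p a b * c$2"
    by (simp_all add: ori_def algebra_simps)
  then have "b$1 = (- ori a b c * p$1 + ori p b c * a$1 + ori p a b * c$1) / ?D"
    "b$2 = (- ori a b c * p$2 + ori p b c * a$2 + ori p a b * c$2) / ?D"
    using assms(4) by (simp_all only: eq_divide_eq mult.commute[of _ ?D]) simp_all
  then have "b = (- ori a b c / ?D) *\<^sub>R p + (ori p b c / ?D) *\<^sub>R a + (ori p a b / ?D) *\<^sub>R c"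
    by (intro plane_eqI) (simp_all add: add_divide_distrib diff_divide_distrib)
  moreover have "- ori a b c / ?D + ori p b c / ?D + ori p a b / ?D = 1"
    using D assms(4) by (metis add_divide_distrib divide_self less_irrefl)
  moreover have "0 \<le> - ori a b c / ?D" "0 \<le> ori p b c / ?D" "0 \<le> ori p a b / ?D"
    using assms by (simp_all add: divide_nonpos_pos)
  ultimately show ?thesis unfolding convex_hull_3 by blast
qed

lemma convex_position_apex:
  assumes "finite P" "convex_position P" "p \<in> P"
  obtains u :: plane where "\<And>x. x \<in> P - {p} \<Longrightarrow> u \<bullet> (x - p) > 0"
proof -
  have "closed (convex hull (P - {p}))"
    using assms(1) by (intro compact_imp_closed finite_imp_compact_convex_hull) simp
  then obtain u b where ub: "u \<bullet> p < b" "\<forall>x\<in>convex hull (P - {p}). b < u \<bullet> x"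
    using separating_hyperplane_closed_point[of "convex hull (P - {p})" p]
      convex_position_not_in_hull[OF assms(2,3)] by auto
  have "u \<bullet> (x - p) > 0" if "x \<in> P - {p}" for x
    using ub hull_inc[OF that, of convex] by (auto simp: inner_diff_right)
  then show ?thesis by (rule that)
qed

text \<open>The points other than \<open>p\<close> lie in an open half plane with \<open>p\<close> on its boundary; \<open>slope u p\<close>
  orders them by angle around \<open>p\<close>.\<close>

definition slope :: "plane \<Rightarrow> plane \<Rightarrow> plane \<Rightarrow> real" where
  "slope u p x = (u$1 * (x$2 - p$2) - u$2 * (x$1 - p$1)) / (u \<bullet> (x - p))"

lemma inner_plane: "(u::plane) \<bullet> v = u$1 * v$1 + u$2 * v$2"
  by (simp add: inner_vec_def sum_2)

text \<open>In the frame of \<open>u\<close> and \<open>u\<close> turned by a right angle,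
  \<open>slope u p x\<close> is the quotient of the two coordinates of \<open>x - p\<close>, the
  tangent of its angle with \<open>u\<close>. The identity is the determinant of
  \<open>x - p\<close> and \<open>y - p\<close> computed in this frame.\<close>

lemma ori_slope:
  assumes "u \<bullet> (x - p) > 0" "u \<bullet> (y - p) > 0"
  shows "(u \<bullet> u) * ori p x y = (u \<bullet> (x - p)) * (u \<bullet> (y - p)) * (slope u p y - slope u p x)"
proof -
  let ?X = "u \<bullet> (x - p)" and ?Y = "u \<bullet> (y - p)"
  let ?x = "u$1 * (x$2 - p$2) - u$2 * (x$1 - p$1)" and ?y = "u$1 * (y$2 - p$2) - u$2 * (y$1 - p$1)"
  have "?X * ?Y * (slope u p y - slope u p x) = ?X * ?y - ?x * ?Y"
    using assms by (simp add: slope_def field_simps)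
  also have "\<dots> = (u \<bullet> u) * ori p x y"
    by (simp add: inner_plane ori_def algebra_simps)
  finally show ?thesis by simp
qed

lemma slope_less_imp_ori_pos:
  assumes "u \<bullet> (x - p) > 0" "u \<bullet> (y - p) > 0" "slope u p x < slope u p y"
  shows "ori p x y > 0"
proof -
  have "(u \<bullet> u) * ori p x y > 0" unfolding ori_slope[OF assms(1,2)] using assms by simp
  then show ?thesis by (simp add: zero_less_mult_iff) (metis inner_ge_zero not_less)
qed

text \<open>Both points lie on one ray from \<open>p\<close>, and the ratio \<open>t\<close> of
  their heights in direction \<open>u\<close> places the lower one on the segment to the
  other.\<close>

lemma collinear_ray:
  assumes X: "u \<bullet> (x - p) > 0" and Y: "u \<bullet> (y - p) > 0" and ori: "ori p x y = 0"
    and le: "u \<bullet> (y - p) \<le> u \<bullet> (x - p)"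
  shows "y \<in> closed_segment p x"
proof -
  let ?X = "u \<bullet> (x - p)" and ?Y = "u \<bullet> (y - p)"
  define t where "t = ?Y / ?X"
  have t: "0 \<le> t" "t \<le> 1" using assms by (simp_all add: t_def)
  have "?X * (y$1 - p$1) = ?Y * (x$1 - p$1) - u$2 * ori p x y"
    "?X * (y$2 - p$2) = ?Y * (x$2 - p$2) + u$1 * ori p x y"
    by (simp_all add: inner_plane ori_def algebra_simps)
  then have "y$1 - p$1 = t * (x$1 - p$1)" "y$2 - p$2 = t * (x$2 - p$2)"
    using X ori by (simp_all add: t_def field_simps)
  then have "y = (1 - t) *\<^sub>R p + t *\<^sub>R x"
    by (intro plane_eqI) (simp_all add: algebra_simps)
  then show ?thesis using t by (auto simp: in_segment)
qed

text \<open>One point \<open>p\<close> comes first, followed by the others in the order of their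
  angle around \<open>p\<close>. Two points at the same angle would put one of them on the segment
  from \<open>p\<close> to the other, against convex position.\<close>

lemma convex_position_ordering:
  assumes fin: "finite P" and cp: "convex_position P" and ne: "P \<noteq> {}"
  obtains zs where "distinct zs" "set zs = P"
    "\<And>i j k. i < j \<Longrightarrow> j < k \<Longrightarrow> k < length zs \<Longrightarrow> ori (zs ! i) (zs ! j) (zs ! k) > 0"
proof -
  obtain p where p: "p \<in> P" using ne by blast
  obtain u :: plane where u: "\<And>x. x \<in> P - {p} \<Longrightarrow> u \<bullet> (x - p) > 0"
    using convex_position_apex[OF fin cp p] by blast
  define key where "key = slope u p"
  have inj: "inj_on key (P - {p})"
  proof (rule inj_onI, rule ccontr)
    fix x y assume xy: "x \<in> P - {p}" "y \<in> P - {p}" "key x = key y" "x \<noteq> y"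
    have "u \<noteq> 0" using u[OF xy(1)] by auto
    then have o: "ori p x y = 0" "ori p y x = 0"
      using ori_slope[OF u[OF xy(1)] u[OF xy(2)]] ori_swap[of p x y] xy(3) by (simp_all add: key_def)
    have "y \<in> closed_segment p x \<or> x \<in> closed_segment p y"
      using collinear_ray[OF u[OF xy(1)] u[OF xy(2)] o(1)] collinear_ray[OF u[OF xy(2)] u[OF xy(1)] o(2)]
      by linarith
    then show False
      using convex_position_not_in_segment[OF cp, of y p x] convex_position_not_in_segment[OF cp, of x p y]
        p xy by auto
  qed
  define ks where "ks = sorted_list_of_set (key ` (P - {p}))"
  have ks: "set ks = key ` (P - {p})" "sorted_wrt (<) ks"
    using fin by (simp_all add: ks_def)
  define ys where "ys = map (inv_into (P - {p}) key) ks"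
  have set_ys: "set ys = P - {p}"
    by (simp add: ys_def ks(1) inv_into_image_cancel[OF inj])
  have "distinct ks" using fin by (simp add: ks_def)
  then have dist: "distinct ys"
    unfolding ys_def distinct_map ks(1) by (simp add: inj_on_inv_into)
  have key_ys: "key (ys ! i) = ks ! i" if "i < length ys" for i
  proof -
    have "ks ! i \<in> key ` (P - {p})" using that ks(1) nth_mem[of i ks] by (simp add: ys_def)
    then show ?thesis using that by (simp add: ys_def f_inv_into_f)
  qed
  have mono: "ori p (ys ! i) (ys ! j) > 0" if "i < j" "j < length ys" for i j
  proof (rule slope_less_imp_ori_pos)
    have mem: "ys ! i \<in> P - {p}" "ys ! j \<in> P - {p}"
      using that set_ys nth_mem[of i ys] nth_mem[of j ys] by auto
    then show "u \<bullet> (ys ! i - p) > 0" "u \<bullet> (ys ! j - p) > 0" using u by auto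
    show "slope u p (ys ! i) < slope u p (ys ! j)"
      using that key_ys[of i] key_ys[of j] sorted_wrt_nth_less[OF ks(2), of i j]
      by (simp add: key_def ys_def)
  qed
  \<comment> \<open>Otherwise \<open>ys ! j\<close> would lie in the triangle of \<open>p\<close>,
    \<open>ys ! i\<close> and \<open>ys ! k\<close>.\<close>
  have tri: "ori (ys ! i) (ys ! j) (ys ! k) > 0" if ijk: "i < j" "j < k" "k < length ys" for i j k
  proof (rule ccontr)
    assume "\<not> ?thesis"
    then have "ys ! j \<in> convex hull {p, ys ! i, ys ! k}"
      using mono[of i j] mono[of j k] mono[of i k] ijk by (intro in_triangle) auto
    moreover have "{p, ys ! i, ys ! k} \<subseteq> P - {ys ! j}"
      using ijk set_ys p dist nth_mem[of i ys] nth_mem[of j ys] nth_mem[of k ys]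
      by (auto simp: nth_eq_iff_index_eq)
    then have "convex hull {p, ys ! i, ys ! k} \<subseteq> convex hull (P - {ys ! j})" by (rule hull_mono)
    moreover have "ys ! j \<in> P" using ijk set_ys nth_mem[of j ys] by auto
    ultimately show False using convex_position_not_in_hull[OF cp] by blast
  qed
  show ?thesis
  proof (rule that[of "p # ys"])
    show "distinct (p # ys)" using dist set_ys by simp
    show "set (p # ys) = P" using set_ys p by auto
    fix i j k assume ijk: "i < j" "j < k" "k < length (p # ys)"
    then obtain j' k' where jk: "j = Suc j'" "k = Suc k'" by (metis less_imp_Suc_add)
    show "ori ((p # ys) ! i) ((p # ys) ! j) ((p # ys) ! k) > 0"
      using ijk mono[of j' k'] tri[of _ j' k'] jk by (cases i) auto
  qed
qed

section \<open>Crossing of segments and interleaving of end points\<close>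

lemma crossing_iff_open_segments:
  assumes "a \<noteq> b" "c \<noteq> d"
  shows "crossing (closed_segment a b) (closed_segment c d) \<longleftrightarrow>
    {a, b} \<noteq> {c, d} \<and> open_segment a b \<inter> open_segment c d \<noteq> {}"
  using assms by (simp add: crossing_def rel_interior_closed_segment)

lemma ori_open_segment:
  assumes "x \<in> open_segment a b"
  shows "ori a b x = 0"
proof -
  obtain t where "x = (1 - t) *\<^sub>R a + t *\<^sub>R b" using assms by (auto simp: in_segment)
  then show ?thesis by (simp add: ori_affine)
qed

text \<open>On \<open>open_segment c d\<close> the function \<open>ori a b\<close> is a combination
  of its values at \<open>c\<close> and \<open>d\<close> with positive weights. Values of the same
  sign, not both zero, cannot cancel, whereas \<open>ori a b\<close> vanishes on
  \<open>open_segment a b\<close>.\<close>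

lemma open_segments_disjoint:
  assumes "(ori a b c \<ge> 0 \<and> ori a b d \<ge> 0) \<or> (ori a b c \<le> 0 \<and> ori a b d \<le> 0)"
    "ori a b c \<noteq> 0 \<or> ori a b d \<noteq> 0"
  shows "open_segment a b \<inter> open_segment c d = {}"
proof (rule ccontr)
  assume "\<not> ?thesis"
  then obtain x where x: "x \<in> open_segment a b" "x \<in> open_segment c d" by blast
  obtain t where t: "0 < t" "t < 1" "x = (1 - t) *\<^sub>R c + t *\<^sub>R d" using x(2) by (auto simp: in_segment)
  then have zero: "(1 - t) * ori a b c + t * ori a b d = 0"
    using ori_open_segment[OF x(1)] by (simp add: ori_affine)
  from assms(1) show False
  proof
    assume "ori a b c \<ge> 0 \<and> ori a b d \<ge> 0"
    then have "(1 - t) * ori a b c = 0 \<and> t * ori a b d = 0"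
      using zero t by (subst (asm) add_nonneg_eq_0_iff) auto
    then show False using assms(2) t by simp
  next
    assume "ori a b c \<le> 0 \<and> ori a b d \<le> 0"
    then have "(1 - t) * ori a b c = 0 \<and> t * ori a b d = 0"
      using zero t by (subst (asm) add_nonpos_eq_0_iff) (auto simp: mult_le_0_iff)
    then show False using assms(2) t by simp
  qed
qed

text \<open>\<open>ori c d\<close> is affine along the segment from \<open>a\<close> to
  \<open>b\<close> and vanishes at parameter \<open>s\<close>; \<open>ori a b\<close> does so along
  the other segment at \<open>t\<close>. Both have total variation \<open>D\<close>, and the two
  zeros are the same point.\<close>

lemma open_segments_meet:
  assumes c: "ori a b c < 0" and d: "ori a b d > 0" and a: "ori c d a > 0" and b: "ori c d b < 0"
  shows "open_segment a b \<inter> open_segment c d \<noteq> {}"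
proof -
  define D where "D = ori a b d - ori a b c"
  have D: "D > 0" using c d by (simp add: D_def)
  have D': "D = ori c d a - ori c d b" by (simp add: D_def ori_def algebra_simps)
  define s where "s = ori c d a / D"
  define t where "t = - ori a b c / D"
  have "ori c d a < D" using D' b by simp
  moreover have "- ori a b c < D" using d by (simp add: D_def)
  ultimately have "0 < s" "s < 1" "0 < t" "t < 1"
    unfolding s_def t_def using a c D by (simp_all only: divide_less_eq_1_pos zero_less_divide_iff) simp_all
  moreover have "(1 - s) *\<^sub>R a + s *\<^sub>R b = (1 - t) *\<^sub>R c + t *\<^sub>R d"
  proof (rule plane_eqI)
    have eq: "(D - ori c d a) * a$i + ori c d a * b$i = (D + ori a b c) * c$i - ori a b c * d$i"
      if "i = 1 \<or> i = 2" for i :: 2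
      using that unfolding D_def ori_def by (elim disjE) (simp_all add: algebra_simps)
    have scale: "(1 - s) * x + s * y = ((D - ori c d a) * x + ori c d a * y) / D"
      "(1 - t) * x + t * y = ((D + ori a b c) * x - ori a b c * y) / D" for x y
      using D by (simp_all add: s_def t_def field_simps)
    show "((1 - s) *\<^sub>R a + s *\<^sub>R b)$1 = ((1 - t) *\<^sub>R c + t *\<^sub>R d)$1"
      using eq[of 1] by (simp add: scale)
    show "((1 - s) *\<^sub>R a + s *\<^sub>R b)$2 = ((1 - t) *\<^sub>R c + t *\<^sub>R d)$2"
      using eq[of 2] by (simp add: scale)
  qed
  moreover have "a \<noteq> b" "c \<noteq> d" using a c by auto
  ultimately have "(1 - s) *\<^sub>R a + s *\<^sub>R b \<in> open_segment a b" "(1 - s) *\<^sub>R a + s *\<^sub>R b \<in> open_segment c d"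
    unfolding in_segment by auto
  then show ?thesis by blast
qed

text \<open>The sign of \<open>ori (zs ! a) (zs ! b) (zs ! e)\<close> is negative for
  \<open>e\<close> strictly between \<open>a\<close> and \<open>b\<close>, zero at both, and
  positive elsewhere. Distinct segments therefore cross only if \<open>c\<close> and
  \<open>d\<close> receive strictly opposite signs.\<close>

lemma crossing_iff_interleaved:
  assumes dist: "distinct zs"
    and ccw: "\<And>i j k. i < j \<Longrightarrow> j < k \<Longrightarrow> k < length zs \<Longrightarrow> ori (zs ! i) (zs ! j) (zs ! k) > 0"
    and ab: "a < b" "b < length zs" and cd: "c < d" "d < length zs"
  shows "crossing (closed_segment (zs ! a) (zs ! b)) (closed_segment (zs ! c) (zs ! d)) \<longleftrightarrow>
    (a < c \<and> c < b \<and> b < d) \<or> (c < a \<and> a < d \<and> d < b)"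
proof -
  have neq: "zs ! a \<noteq> zs ! b" "zs ! c \<noteq> zs ! d"
    using dist ab cd by (simp_all add: nth_eq_iff_index_eq)
  have inside: "ori (zs ! a) (zs ! b) (zs ! e) < 0" if "a < e" "e < b" for e
    using ccw[of a e b] that ab ori_swap[of "zs ! a" "zs ! b" "zs ! e"] by simp
  have outside: "ori (zs ! a) (zs ! b) (zs ! e) > 0" if "e < a \<or> b < e" "e < length zs" for e
    using ccw[of e a b] ccw[of a b e] that ab ori_cyclic[of "zs ! e" "zs ! a" "zs ! b"] by auto
  have meet: "open_segment (zs ! i) (zs ! k) \<inter> open_segment (zs ! j) (zs ! l) \<noteq> {}"
    if "i < j" "j < k" "k < l" "l < length zs" for i j k l
    using ccw[of i j k] ccw[of i k l] ccw[of i j l] ccw[of j k l] that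
      ori_swap[of "zs ! i" "zs ! j" "zs ! k"] ori_swap[of "zs ! j" "zs ! k" "zs ! l"]
      ori_cyclic[of "zs ! i" "zs ! j" "zs ! l"]
    by (intro open_segments_meet) auto
  have set_eq: "{zs ! a, zs ! b} = {zs ! c, zs ! d} \<longleftrightarrow> a = c \<and> b = d"
    using dist ab cd by (auto simp: doubleton_eq_iff nth_eq_iff_index_eq)
  show ?thesis
  proof
    assume "crossing (closed_segment (zs ! a) (zs ! b)) (closed_segment (zs ! c) (zs ! d))"
    then have ne: "\<not> (a = c \<and> b = d)" and
      "open_segment (zs ! a) (zs ! b) \<inter> open_segment (zs ! c) (zs ! d) \<noteq> {}"
      by (simp_all add: crossing_iff_open_segments[OF neq] set_eq)
    then have *: "\<not> ((ori (zs ! a) (zs ! b) (zs ! c) \<ge> 0 \<and> ori (zs ! a) (zs ! b) (zs ! d) \<ge> 0 \<or>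
        ori (zs ! a) (zs ! b) (zs ! c) \<le> 0 \<and> ori (zs ! a) (zs ! b) (zs ! d) \<le> 0) \<and>
        (ori (zs ! a) (zs ! b) (zs ! c) \<noteq> 0 \<or> ori (zs ! a) (zs ! b) (zs ! d) \<noteq> 0))"
      using open_segments_disjoint by blast
    have sgn: "(e < a \<or> b < e) \<and> ori (zs ! a) (zs ! b) (zs ! e) > 0 \<or>
        (a < e \<and> e < b) \<and> ori (zs ! a) (zs ! b) (zs ! e) < 0 \<or>
        (e = a \<or> e = b) \<and> ori (zs ! a) (zs ! b) (zs ! e) = 0" if "e < length zs" for e
      using inside[of e] outside[of e] that by (cases "e < a"; cases "e = a"; cases "e < b"; cases "e = b") auto
    show "(a < c \<and> c < b \<and> b < d) \<or> (c < a \<and> a < d \<and> d < b)"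
      using * ne sgn[OF less_trans[OF cd]] sgn[OF cd(2)] cd(1) ab(1) by (smt (verit) less_trans)
  next
    assume inter: "(a < c \<and> c < b \<and> b < d) \<or> (c < a \<and> a < d \<and> d < b)"
    then have "\<not> (a = c \<and> b = d)" by auto
    moreover have "open_segment (zs ! a) (zs ! b) \<inter> open_segment (zs ! c) (zs ! d) \<noteq> {}"
      using inter meet[of a c b d] meet[of c a d b] ab cd by (auto simp: Int_commute)
    ultimately show "crossing (closed_segment (zs ! a) (zs ! b)) (closed_segment (zs ! c) (zs ! d))"
      by (simp add: crossing_iff_open_segments[OF neq] set_eq)
  qed
qed

section \<open>Transfer to the path graph of a point set\<close>

lemma exchange_image_iff:
  assumes "inj_on F (S \<union> T)"
  shows "exchange (F ` S) (F ` T) \<longleftrightarrow> exchange S T"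
proof
  assume e: "exchange (F ` S) (F ` T)"
  let ?K = "inv_into (S \<union> T) F"
  have "inj_on ?K (F ` S \<union> F ` T)" by (rule inj_on_inv_into) auto
  then have "exchange (?K ` F ` S) (?K ` F ` T)" using e by (rule exchange_image)
  then show "exchange S T" using assms by (simp add: inv_into_image_cancel)
next
  show "exchange S T \<Longrightarrow> exchange (F ` S) (F ` T)" using assms by (rule exchange_image)
qed

text \<open>As convex hulls, segments are images of unordered pairs under a single map, with no
  choice of direction.\<close>

lemma path_edges_conv_pedges: "path_edges xs = (\<lambda>e. convex hull e) ` pedges xs"
proof -
  have "path_edges xs = (\<lambda>e. convex hull e) ` pedges xs" for xs
    by (induction xs rule: pedges.induct) (auto simp: path_edges_def segment_convex_hull)
  then show ?thesis .
qed

text \<open>In a complete graph any two distinct vertices are joined, so only distinctness of the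
  list remains; \<open>P\<close> is nonempty because a walk is a nonempty list.\<close>

lemma spanning_paths_eq:
  assumes "P \<noteq> {}"
  shows "spanning_paths P = {path_edges xs | xs. distinct xs \<and> set xs = P}"
proof -
  have arcs: "set (vwalk_arcs xs) \<subseteq> {(p, q). p \<in> set xs \<and> q \<in> set xs \<and> p \<noteq> q}" if "distinct xs" for xs :: "plane list"
    using that by (induction xs rule: vwalk_arcs.induct) auto
  have "vpath xs (with_proj (complete_geometric_graph P)) \<longleftrightarrow> distinct xs" if "set xs = P" for xs
    using arcs[of xs] that assms by (auto simp: vpath_def vwalk_def complete_geometric_graph_def)
  then show ?thesis unfolding spanning_paths_def by metis
qed

context ngon
begin

text \<open>With the quadruple started at the smaller end point \<open>a\<close> of the first edge,
  only its last member \<open>w\<close> can exceed the range \<open>{0..<N}\<close>. Whether it does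
  decides between the two alternatives.\<close>

lemma cross_iff_interleaved:
  assumes "a \<in> Z" "b \<in> Z" "c \<in> Z" "d \<in> Z" "a < b" "c < d"
  shows "cross {a, b} {c, d} \<longleftrightarrow> (a < c \<and> c < b \<and> b < d) \<or> (c < a \<and> a < d \<and> d < b)"
proof
  assume "(a < c \<and> c < b \<and> b < d) \<or> (c < a \<and> a < d \<and> d < b)"
  then show "cross {a, b} {c, d}"
    using assms crossI[of a c b d] crossI[of c a d b, THEN cross_sym] by (auto simp: r_id Z_def)
next
  assume "cross {a, b} {c, d}"
  then obtain y z w where *: "a < y" "y < z" "z < w" "w < a + N" "{a, b} = {r a, r z}" "{c, d} = {r y, r w}"
    using crossE_at[of "{a, b}" "{c, d}" a] r_id[OF assms(1)] by auto
  \<comment> \<open>Representatives between \<open>a\<close> and \<open>a + N\<close> lie below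
    \<open>2 * N\<close>, so reduction subtracts \<open>N\<close> at most once.\<close>
  have red: "r x = (if x < N then x else x - N)" if "a < x" "x < a + N" for x
    using that assms(1) r_id[of x] r_id[of "x - N"] by (auto simp: Z_def)
  have "b = r z" using * assms r_id[of a] by (auto simp: doubleton_eq_iff)
  moreover have "(c = r y \<and> d = r w) \<or> (c = r w \<and> d = r y)" using *(6) by (auto simp: doubleton_eq_iff)
  ultimately show "(a < c \<and> c < b \<and> b < d) \<or> (c < a \<and> a < d \<and> d < b)"
    using red[of y] red[of z] red[of w] * assms by (auto simp: Z_def split: if_splits)
qed

lemma crossing_iff_cross:
  assumes dist: "distinct zs" and len: "length zs = n"
    and ccw: "\<And>i j k. i < j \<Longrightarrow> j < k \<Longrightarrow> k < length zs \<Longrightarrow> ori (zs ! i) (zs ! j) (zs ! k) > 0"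
    and mem: "a \<in> Z" "b \<in> Z" "c \<in> Z" "d \<in> Z" and neq: "a \<noteq> b" "c \<noteq> d"
  defines "p \<equiv> \<lambda>x. zs ! nat x"
  shows "crossing (closed_segment (p a) (p b)) (closed_segment (p c) (p d)) \<longleftrightarrow> cross {a, b} {c, d}"
proof -
  have *: "crossing (closed_segment (p a) (p b)) (closed_segment (p c) (p d)) \<longleftrightarrow> cross {a, b} {c, d}"
    if "a \<in> Z" "b \<in> Z" "c \<in> Z" "d \<in> Z" "a < b" "c < d" for a b c d
    unfolding cross_iff_interleaved[OF that] p_def
    using that len by (subst crossing_iff_interleaved[OF dist ccw]) (auto simp: Z_def nat_less_iff)
  have **: "crossing (closed_segment (p a) (p b)) (closed_segment (p c) (p d)) \<longleftrightarrow> cross {a, b} {c, d}"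
    if "a \<in> Z" "b \<in> Z" "c \<in> Z" "d \<in> Z" "a < b" "c \<noteq> d" for a b c d
  proof (cases "c < d")
    case True
    then show ?thesis using * that by simp
  next
    case False
    then show ?thesis
      using *[of a b d c] that unfolding closed_segment_commute[of "p c" "p d"] insert_commute[of c d]
      by simp
  qed
  show ?thesis
  proof (cases "a < b")
    case True
    then show ?thesis using ** mem neq by simp
  next
    case False
    then show ?thesis
      using **[of b a c d] mem neq unfolding closed_segment_commute[of "p a" "p b"] insert_commute[of a b]
      by simp
  qed
qed

text \<open>On the pairs in \<open>E\<close>, the map \<open>seg\<close> is injective and turns
  \<open>cross\<close> into \<open>crossing\<close>; taking images of edge sets is therefore an
  isomorphism of graphs, and \<open>Aut_iso\<close> applies.\<close>

lemma path_graph_iso_comb_graph: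
  assumes dist: "distinct zs" and len: "length zs = n" and P: "set zs = P"
    and ccw: "\<And>i j k. i < j \<Longrightarrow> j < k \<Longrightarrow> k < length zs \<Longrightarrow> ori (zs ! i) (zs ! j) (zs ! k) > 0"
  shows "Aut comb_graph \<cong> Aut (path_graph P)"
proof -
  define p where "p = (\<lambda>x. zs ! nat x)"
  have inj_p: "inj_on p Z"
    using dist len by (auto simp: inj_on_def p_def Z_def nth_eq_iff_index_eq)
  have p_image: "p ` Z = P"
  proof -
    have "nat ` Z = {..<n}" unfolding Z_def by (force simp: image_iff intro: bexI[of _ "int _"])
    then have "p ` Z = (!) zs ` {..<n}" unfolding p_def by (simp flip: image_image)
    then show ?thesis using P len by (auto simp: in_set_conv_nth image_iff)
  qed
  have ne: "P \<noteq> {}" using P len n_ge by auto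
  define seg where "seg = (\<lambda>e. convex hull (p ` e))"
  have seg: "seg {a, b} = closed_segment (p a) (p b)" for a b by (simp add: seg_def segment_convex_hull)
  define E where "E = {{a, b} | a b. a \<in> Z \<and> b \<in> Z \<and> a \<noteq> b}"
  have inj_seg: "inj_on seg E"
  proof (rule inj_onI)
    fix e f assume ef: "e \<in> E" "f \<in> E" and eq: "seg e = seg f"
    obtain a b where ab: "e = {a, b}" "a \<in> Z" "b \<in> Z" using ef by (auto simp: E_def)
    obtain c d where cd: "f = {c, d}" "c \<in> Z" "d \<in> Z" using ef by (auto simp: E_def)
    \<comment> \<open>A segment determines the set of its end points.\<close>
    have "p ` {a, b} = p ` {c, d}" using eq ab cd by (simp add: seg)
    then show "e = f" using inj_on_image_eq_iff[OF inj_p, of "{a, b}" "{c, d}"] ab cd by simp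
  qed
  have cross_seg: "crossing (seg e) (seg f) \<longleftrightarrow> cross e f" if "e \<in> E" "f \<in> E" for e f
  proof -
    obtain a b where ab: "e = {a, b}" "a \<in> Z" "b \<in> Z" "a \<noteq> b" using \<open>e \<in> E\<close> by (auto simp: E_def)
    obtain c d where cd: "f = {c, d}" "c \<in> Z" "d \<in> Z" "c \<noteq> d" using \<open>f \<in> E\<close> by (auto simp: E_def)
    show ?thesis unfolding ab(1) cd(1) seg p_def
      by (rule crossing_iff_cross[OF dist len ccw]) (use ab cd in auto)
  qed
  have pedges_E: "pedges xs \<subseteq> E" if xs: "distinct xs" "set xs = Z" for xs
  proof
    fix e assume "e \<in> pedges xs"
    then obtain x y where "e = {x, y}" "x \<noteq> y" "x \<in> set xs" "y \<in> set xs"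
      using pedges_doubleton[OF xs(1)] by metis
    then show "e \<in> E" using xs(2) unfolding E_def by blast
  qed
  have SP_E: "S \<subseteq> E" if "S \<in> SP" for S using that pedges_E by (auto simp: SP_def)
  have seg_pedges: "seg ` pedges xs = path_edges (map p xs)" for xs
    by (simp add: path_edges_conv_pedges pedges_map image_image seg_def)
  have simple_iff: "(\<forall>e\<in>seg ` S. \<forall>f\<in>seg ` S. \<not> crossing e f) \<longleftrightarrow> simple S" if "S \<subseteq> E" for S
    using cross_seg that unfolding simple_def by blast
  have image: "(`) seg ` SP = simple_spanning_paths P"
  proof (intro subset_antisym subsetI)
    fix T assume "T \<in> (`) seg ` SP"
    then obtain S where S: "S \<in> SP" "T = seg ` S" by blast
    then obtain xs where xs: "S = pedges xs" "distinct xs" "set xs = Z" "simple S" by (auto simp: SP_def)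
    have "distinct (map p xs)" "set (map p xs) = P" using xs inj_p p_image by (simp_all add: distinct_map)
    then have "T \<in> spanning_paths P" unfolding spanning_paths_eq[OF ne] using S xs seg_pedges by blast
    then show "T \<in> simple_spanning_paths P"
      using simple_iff[OF SP_E[OF S(1)]] xs(4) S(2) by (simp add: simple_spanning_paths_def)
  next
    fix T assume T: "T \<in> simple_spanning_paths P"
    then obtain ys where ys: "T = path_edges ys" "distinct ys" "set ys = P"
      by (auto simp: simple_spanning_paths_def spanning_paths_eq[OF ne])
    define xs where "xs = map (inv_into Z p) ys"
    have inv: "inv_into Z p y \<in> Z" "p (inv_into Z p y) = y" if "y \<in> P" for y
      using that p_image by (auto simp: inv_into_into f_inv_into_f)
    have map_xs: "map p xs = ys" unfolding xs_def map_map
      by (rule map_idI) (use inv ys in auto)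
    have "set xs = inv_into Z p ` (p ` Z)" using ys p_image by (simp add: xs_def)
    then have xs: "distinct xs" "set xs = Z"
      using map_xs ys(2) inj_p by (auto simp: distinct_map inv_into_image_cancel)
    have T_eq: "T = seg ` pedges xs" using ys map_xs seg_pedges[of xs] by simp
    have "simple (pedges xs)"
      using simple_iff[OF pedges_E[OF xs]] T T_eq by (simp add: simple_spanning_paths_def)
    then show "T \<in> (`) seg ` SP" using xs T_eq by (auto simp: SP_def)
  qed
  have "inj_on ((`) seg) SP"
    by (rule inj_on_subset[OF inj_on_image_Pow[OF inj_seg]]) (use SP_E in auto)
  then have bij: "bij_betw ((`) seg) (pverts comb_graph) (pverts (path_graph P))"
    using image by (simp add: bij_betw_def comb_graph_def path_graph_def)
  have arcs: "(seg ` S, seg ` T) \<in> parcs (path_graph P) \<longleftrightarrow> (S, T) \<in> parcs comb_graph"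
    if "S \<in> pverts comb_graph" "T \<in> pverts comb_graph" for S T
  proof -
    have ST: "S \<in> SP" "T \<in> SP" using that by (simp_all add: comb_graph_def)
    have "inj_on seg (S \<union> T)" using SP_E ST by (intro inj_on_subset[OF inj_seg]) auto
    moreover have "seg ` S \<in> simple_spanning_paths P" "seg ` T \<in> simple_spanning_paths P"
      using ST image by blast+
    ultimately show ?thesis
      using ST exchange_image_iff[of seg S T]
      by (simp add: path_graph_def comb_graph_def exchange_def)
  qed
  show ?thesis by (rule Aut_iso[OF bij arcs])
qed

end

theorem theorem1:
  fixes P :: "plane set" and n :: nat
  assumes "finite P" and "card P = n" and "n \<ge> 5"
    and "convex_position P"
  shows "Aut (path_graph P) \<cong> dihedral_group n"
proof -
  interpret ngon n using assms(3) by unfold_locales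
  have "P \<noteq> {}" using assms by auto
  then obtain zs where zs: "distinct zs" "set zs = P"
    "\<And>i j k. i < j \<Longrightarrow> j < k \<Longrightarrow> k < length zs \<Longrightarrow> ori (zs ! i) (zs ! j) (zs ! k) > 0"
    using convex_position_ordering[OF assms(1,4)] by metis
  have "length zs = n" using zs assms(2) distinct_card by metis
  then have "Aut comb_graph \<cong> Aut (path_graph P)"
    using path_graph_iso_comb_graph zs by blast
  then have iso: "dihedral_group n \<cong> Aut (path_graph P)"
    by (rule iso_trans[OF dihedral_iso_Aut_comb_graph])
  have "group (dihedral_group n)" using assms(3) by (intro group_dihedral_group) simp
  then show ?thesis using iso by (rule group.iso_sym)
qed

end
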